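(* Let $V$ be a right quaternionic Hilbert space and $A\in\mathcal B(V)$. (a) If $A$ has SVEP, then $\sigma_{ka}^S(A)=\sigma_{ap}^S(A)$. (b) If $A^\dagger$ has SVEP, then $\sigma_{ka}^S(A)=\sigma_{su}^S(A)$. (c) If $A$ and $A^\dagger$ both have SVEP, then $\sigma_{ka}^S(A)=\sigma_S(A)$.
   Context: $\mathbb H$ denotes the quaternions. A right quaternionic Hilbert space $V$ is a right $\mathbb H$-vector space with an $\mathbb H$-valued inner product satisfying $\overline{\langle\phi|\psi\rangle}=\langle\psi|\phi\rangle$, additivity, $\langle\phi|\psi\mathfrak q\rangle=\langle\phi|\psi\rangle\mathfrak q$, $\langle\phi\mathfrak q|\psi\rangle=\overline{\mathfrak q}\langle\phi|\psi\rangle$ and $\|\phi\|^2=\langle\phi|\phi\rangle>0$ for $\phi\ne0$, complete in this norm and separable. $\mathcal B(V)$ is the set of bounded right $\mathbb H$-linear operators $V\to V$; $A^\dagger$ is the adjoint. For $\mathfrak q\in\mathbb H$, $R_{\mathfrak q}(A)=A^2-2\,\mathrm{Re}(\mathfrak q)A+|\mathfrak q|^2 I$. $\sigma_S(A)=\{\mathfrak q: R_{\mathfrak q}(A)\text{ has no inverse in }\mathcal B(V)\}$; $\sigma_{ap}^S(A)=\{\mathfrak q:\exists\,(\phi_n),\ \|\phi_n\|=1,\ \|R_{\mathfrak q}(A)\phi_n\|\to0\}$; $\sigma_{su}^S(A)=\{\mathfrak q:\mathrm{ran}(R_{\mathfrak q}(A))\ne V\}$. Kato S-resolvent set: $\rho_{ka}^S(A)$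 is the set of $\mathfrak q\in\mathbb H$ such that $\mathrm{ran}(R_{\mathfrak q}(A))$ is closed and $\ker(R_{\mathfrak q}(A))\subseteq\bigcap_{n\in\mathbb N}\mathrm{ran}(R_{\mathfrak q}(A)^n)$; the Kato S-spectrum is $\sigma_{ka}^S(A)=\mathbb H\setminus\rho_{ka}^S(A)$. Let $\mathbb S=\{I\in\mathbb H: I^2=-1\}$ and $L_I=\mathbb R+I\mathbb R$. A real differentiable function $f:U\to V$ on an open set $U\subseteq\mathbb H$ is right slice-regular if for every $I\in\mathbb S$ the restriction $f_I=f|_{U\cap L_I}$ has continuous partial derivatives and satisfies $\frac{\partial f_I(x+yI)}{\partial x}+\frac{\partial f_I(x+yI)}{\partial y}I=0$ on $U\cap L_I$. SVEP (single-valued extension property): $A$ has SVEP at $\mathfrak q_0\in\mathbb H$ if for every open neighborhood $U\subseteq\mathbb H$ of $\mathfrak q_0$, the only continuous right slice-regular $f:U\to V$ with $R_{\mathfrak q}(A)f(\mathfrak q)=0$ for all $\mathfrak q\in U$ is the zero function. $A$ has SVEP if it has SVEP at every point of $\mathbb H$. *)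

theory Defs
  imports "HOL-Analysis.Analysis"
begin

section \<open>Quaternions\<close>

datatype quat = Quat (qRe: real) (qI: real) (qJ: real) (qK: real)

lemma quat_eq_iff:
  "p = q \<longleftrightarrow> qRe p = qRe q \<and> qI p = qI q \<and> qJ p = qJ q \<and> qK p = qK q"
  by (cases p; cases q) simp

instantiation quat :: ring_1
begin

definition zero_quat :: quat where "0 = Quat 0 0 0 0"
definition one_quat :: quat where "1 = Quat 1 0 0 0"
definition plus_quat :: "quat \<Rightarrow> quat \<Rightarrow> quat" where
  "p + q = Quat (qRe p + qRe q) (qI p + qI q) (qJ p + qJ q) (qK p + qK q)"
definition uminus_quat :: "quat \<Rightarrow> quat" where
  "- p = Quat (- qRe p) (- qI p) (- qJ p) (- qK p)"
definition minus_quat :: "quat \<Rightarrow> quat \<Rightarrow> quat" where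
  "p - q = Quat (qRe p - qRe q) (qI p - qI q) (qJ p - qJ q) (qK p - qK q)"
definition times_quat :: "quat \<Rightarrow> quat \<Rightarrow> quat" where
  "p * q = Quat
     (qRe p * qRe q - qI p * qI q - qJ p * qJ q - qK p * qK q)
     (qRe p * qI q + qI p * qRe q + qJ p * qK q - qK p * qJ q)
     (qRe p * qJ q - qI p * qK q + qJ p * qRe q + qK p * qI q)
     (qRe p * qK q + qI p * qJ q - qJ p * qI q + qK p * qRe q)"

instance
  by standard
    (simp_all add: quat_eq_iff zero_quat_def one_quat_def plus_quat_def uminus_quat_def
      minus_quat_def times_quat_def algebra_simps)

end

lemma quat_sel [simp]:
  "qRe 0 = 0" "qI 0 = 0" "qJ 0 = 0" "qK 0 = 0"
  "qRe 1 = 1" "qI 1 = 0" "qJ 1 = 0" "qK 1 = 0"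
  "qRe (p + q) = qRe p + qRe q" "qI (p + q) = qI p + qI q"
  "qJ (p + q) = qJ p + qJ q" "qK (p + q) = qK p + qK q"
  "qRe (- p) = - qRe p" "qI (- p) = - qI p" "qJ (- p) = - qJ p" "qK (- p) = - qK p"
  "qRe (p - q) = qRe p - qRe q" "qI (p - q) = qI p - qI q"
  "qJ (p - q) = qJ p - qJ q" "qK (p - q) = qK p - qK q"
  by (simp_all add: zero_quat_def one_quat_def plus_quat_def uminus_quat_def minus_quat_def)

lemma quat_sel_times [simp]:
  "qRe (p * q) = qRe p * qRe q - qI p * qI q - qJ p * qJ q - qK p * qK q"
  "qI (p * q) = qRe p * qI q + qI p * qRe q + qJ p * qK q - qK p * qJ q"
  "qJ (p * q) = qRe p * qJ q - qI p * qK q + qJ p * qRe q + qK p * qI q"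
  "qK (p * q) = qRe p * qK q + qI p * qJ q - qJ p * qI q + qK p * qRe q"
  by (simp_all add: times_quat_def)

instantiation quat :: real_algebra_1
begin

definition scaleR_quat :: "real \<Rightarrow> quat \<Rightarrow> quat" where
  "r *\<^sub>R q = Quat (r * qRe q) (r * qI q) (r * qJ q) (r * qK q)"

instance
  by standard (simp_all add: quat_eq_iff scaleR_quat_def algebra_simps)

end

lemma quat_sel_scaleR [simp]:
  "qRe (r *\<^sub>R q) = r * qRe q" "qI (r *\<^sub>R q) = r * qI q"
  "qJ (r *\<^sub>R q) = r * qJ q" "qK (r *\<^sub>R q) = r * qK q"
  by (simp_all add: scaleR_quat_def)

lemma quat_sel_of_real [simp]:
  "qRe (of_real r) = r" "qI (of_real r) = 0" "qJ (of_real r) = 0" "qK (of_real r) = 0"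
  by (simp_all add: of_real_def)

definition qcnj :: "quat \<Rightarrow> quat" where
  "qcnj q = Quat (qRe q) (- qI q) (- qJ q) (- qK q)"

lemma qcnj_sel [simp]:
  "qRe (qcnj q) = qRe q" "qI (qcnj q) = - qI q" "qJ (qcnj q) = - qJ q" "qK (qcnj q) = - qK q"
  by (simp_all add: qcnj_def)

lemma qcnj_mult: "qcnj (p * q) = qcnj q * qcnj p"
  by (simp add: quat_eq_iff algebra_simps)

instantiation quat :: real_inner
begin

definition inner_quat :: "quat \<Rightarrow> quat \<Rightarrow> real" where
  "p \<bullet> q = qRe p * qRe q + qI p * qI q + qJ p * qJ q + qK p * qK q"
definition norm_quat :: "quat \<Rightarrow> real" where
  "norm q = sqrt ((qRe q)\<^sup>2 + (qI q)\<^sup>2 + (qJ q)\<^sup>2 + (qK q)\<^sup>2)"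
definition sgn_quat :: "quat \<Rightarrow> quat" where
  "sgn q = q /\<^sub>R norm (q :: quat)"
definition dist_quat :: "quat \<Rightarrow> quat \<Rightarrow> real" where
  "dist p q = norm (p - q :: quat)"
definition uniformity_quat :: "(quat \<times> quat) filter" where
  "uniformity = (INF e\<in>{0<..}. principal {(p :: quat, q). dist p q < e})"
definition open_quat :: "quat set \<Rightarrow> bool" where
  "open (U :: quat set) \<longleftrightarrow> (\<forall>p\<in>U. eventually (\<lambda>(p', q). p' = p \<longrightarrow> q \<in> U) uniformity)"

instance
proof
  fix p q r :: quat and c :: real
  show "dist p q = norm (p - q)" by (rule dist_quat_def)
  show "sgn p = p /\<^sub>R norm p" by (rule sgn_quat_def)
  show "uniformity = (INF e\<in>{0<..}. principal {(p :: quat, q). dist p q < e})"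
    by (rule uniformity_quat_def)
  show "open (U :: quat set) \<longleftrightarrow> (\<forall>p\<in>U. eventually (\<lambda>(p', q). p' = p \<longrightarrow> q \<in> U) uniformity)"
    for U :: "quat set" by (rule open_quat_def)
  show "p \<bullet> q = q \<bullet> p" by (simp add: inner_quat_def mult.commute)
  show "(p + q) \<bullet> r = p \<bullet> r + q \<bullet> r" by (simp add: inner_quat_def algebra_simps)
  show "(c *\<^sub>R p) \<bullet> q = c * (p \<bullet> q)" by (simp add: inner_quat_def algebra_simps)
  show "0 \<le> p \<bullet> p" by (simp add: inner_quat_def)
  show "p \<bullet> p = 0 \<longleftrightarrow> p = 0"
    by (simp add: inner_quat_def quat_eq_iff add_nonneg_eq_0_iff)
  show "norm p = sqrt (p \<bullet> p)"
    by (simp add: norm_quat_def inner_quat_def power2_eq_square)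
qed

end

lemma qcnj_times_self: "qcnj q * q = (norm q)\<^sup>2 *\<^sub>R 1"
  and times_qcnj_self: "q * qcnj q = (norm q)\<^sup>2 *\<^sub>R 1"
  by (simp_all add: quat_eq_iff norm_quat_def) (simp_all add: power2_eq_square)

instantiation quat :: real_normed_div_algebra
begin

definition inverse_quat :: "quat \<Rightarrow> quat" where
  "inverse q = qcnj q /\<^sub>R (norm q)\<^sup>2"
definition divide_quat :: "quat \<Rightarrow> quat \<Rightarrow> quat" where
  "p div q = p * inverse (q :: quat)"

instance
proof
  fix p q :: quat
  show "p \<noteq> 0 \<Longrightarrow> inverse p * p = 1" "p \<noteq> 0 \<Longrightarrow> p * inverse p = 1"
    by (simp_all add: inverse_quat_def qcnj_times_self times_qcnj_self)
  show "p div q = p * inverse q" by (rule divide_quat_def)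
  show "inverse (0 :: quat) = 0" by (simp add: inverse_quat_def)
  have "(norm (p * q))\<^sup>2 *\<^sub>R 1 = (p * q) * qcnj (p * q)"
    by (rule times_qcnj_self [symmetric])
  also have "\<dots> = p * (q * qcnj q) * qcnj p"
    by (simp only: qcnj_mult mult.assoc)
  also have "\<dots> = ((norm q)\<^sup>2 * (norm p)\<^sup>2) *\<^sub>R (1 :: quat)"
    by (simp add: times_qcnj_self)
  finally have "(norm (p * q))\<^sup>2 = (norm p * norm q)\<^sup>2"
    by (simp add: power_mult_distrib quat_eq_iff)
  then show "norm (p * q) = norm p * norm q"
    by (rule power2_eq_imp_eq) simp_all
qed

end

instantiation quat :: euclidean_space
begin

definition Basis_quat :: "quat set" where
  "Basis = {Quat 1 0 0 0, Quat 0 1 0 0, Quat 0 0 1 0, Quat 0 0 0 1}"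

instance
proof
  fix u v :: quat
  show "(Basis :: quat set) \<noteq> {}" and "finite (Basis :: quat set)"
    by (simp_all add: Basis_quat_def)
  show "u \<in> Basis \<Longrightarrow> v \<in> Basis \<Longrightarrow> u \<bullet> v = (if u = v then 1 else 0)"
    unfolding Basis_quat_def inner_quat_def by (elim insertE emptyE) simp_all
  show "(\<forall>v\<in>Basis. u \<bullet> v = 0) \<longleftrightarrow> u = 0"
    by (simp add: Basis_quat_def inner_quat_def quat_eq_iff [of u 0])
qed

end


section \<open>Right quaternionic Hilbert spaces\<close>

text \<open>
  The real scalar multiplication of the normed space is the restriction of the quaternionic
  one, and the ambient norm is the one induced by the inner product (written in quaternions:
  the value of the inner product at \<open>(x, x)\<close> is the real number \<open>\<parallel>x\<parallel>\<^sup>2\<close>). Completeness comes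
  from \<^class>\<open>banach\<close>.
\<close>

class quat_hilbert = banach +
  fixes scaleQ :: "'a \<Rightarrow> quat \<Rightarrow> 'a"  (infixl "*\<^sub>H" 75)
    and qinner :: "'a \<Rightarrow> 'a \<Rightarrow> quat"
  assumes scaleQ_add_left: "(x + y) *\<^sub>H p = x *\<^sub>H p + y *\<^sub>H p"
    and scaleQ_add_right: "x *\<^sub>H (p + q) = x *\<^sub>H p + x *\<^sub>H q"
    and scaleQ_scaleQ: "(x *\<^sub>H p) *\<^sub>H q = x *\<^sub>H (p * q)"
    and scaleQ_of_real: "x *\<^sub>H of_real r = r *\<^sub>R x"
    and qinner_conj: "qcnj (qinner x y) = qinner y x"
    and qinner_add_right: "qinner x (y + z) = qinner x y + qinner x z"
    and qinner_scaleQ_right: "qinner x (y *\<^sub>H q) = qinner x y * q"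
    and qinner_scaleQ_left: "qinner (x *\<^sub>H q) y = qcnj q * qinner x y"
    and qinner_self: "qinner x x = of_real ((norm x)\<^sup>2)"
    and countable_dense: "\<exists>D. countable D \<and> (\<forall>U. open U \<longrightarrow> U \<noteq> {} \<longrightarrow> (\<exists>d\<in>D. d \<in> U))"

instantiation quat :: quat_hilbert
begin

definition scaleQ_quat :: "quat \<Rightarrow> quat \<Rightarrow> quat" where
  "p *\<^sub>H q = p * q"
definition qinner_quat :: "quat \<Rightarrow> quat \<Rightarrow> quat" where
  "qinner p q = qcnj p * q"

instance
proof
  show "\<exists>D :: quat set. countable D \<and> (\<forall>U. open U \<longrightarrow> U \<noteq> {} \<longrightarrow> (\<exists>d\<in>D. d \<in> U))"
    by (rule countable_dense_exists)
  fix p q r :: quat and c :: real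
  show "(p + q) *\<^sub>H r = p *\<^sub>H r + q *\<^sub>H r" "r *\<^sub>H (p + q) = r *\<^sub>H p + r *\<^sub>H q"
    "(p *\<^sub>H q) *\<^sub>H r = p *\<^sub>H (q * r)"
    by (simp_all add: scaleQ_quat_def ring_distribs mult.assoc)
  show "p *\<^sub>H of_real c = c *\<^sub>R p"
    by (simp add: scaleQ_quat_def of_real_def)
  have "qcnj (qcnj p) = p"
    by (simp add: quat_eq_iff)
  then show "qcnj (qinner p q) = qinner q p"
    by (simp add: qinner_quat_def qcnj_mult)
  show "qinner p p = of_real ((norm p)\<^sup>2)"
    by (simp add: qinner_quat_def of_real_def qcnj_times_self)
  show "qinner p (q + r) = qinner p q + qinner p r" "qinner p (q *\<^sub>H r) = qinner p q * r"
    by (simp_all add: qinner_quat_def scaleQ_quat_def ring_distribs mult.assoc)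
  show "qinner (p *\<^sub>H r) q = qcnj r * qinner p q"
    by (simp add: qinner_quat_def scaleQ_quat_def qcnj_mult mult.assoc)
qed

end


section \<open>Bounded operators and S-spectra\<close>

definition bounded_qlinear :: "('v::quat_hilbert \<Rightarrow> 'v) \<Rightarrow> bool" where
  "bounded_qlinear A \<longleftrightarrow> bounded_linear A \<and> (\<forall>x q. A (x *\<^sub>H q) = A x *\<^sub>H q)"

text \<open>
  By the Riesz representation theorem exactly one such \<open>B\<close> exists for bounded \<open>A\<close>.
\<close>

definition qadjoint :: "('v::quat_hilbert \<Rightarrow> 'v) \<Rightarrow> 'v \<Rightarrow> 'v" where
  "qadjoint A = (THE B. bounded_qlinear B \<and> (\<forall>x y. qinner x (A y) = qinner (B x) y))"

definition Rq :: "('v::quat_hilbert \<Rightarrow> 'v) \<Rightarrow> quat \<Rightarrow> 'v \<Rightarrow> 'v" where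
  "Rq A q = (\<lambda>x. A (A x) - (2 * qRe q) *\<^sub>R A x + (norm q)\<^sup>2 *\<^sub>R x)"

definition S_spectrum :: "('v::quat_hilbert \<Rightarrow> 'v) \<Rightarrow> quat set" where
  "S_spectrum A = {q. \<not> (\<exists>B. bounded_qlinear B \<and> B \<circ> Rq A q = id \<and> Rq A q \<circ> B = id)}"

definition approx_S_spectrum :: "('v::quat_hilbert \<Rightarrow> 'v) \<Rightarrow> quat set" where
  "approx_S_spectrum A =
    {q. \<exists>\<phi>. (\<forall>n::nat. norm (\<phi> n) = 1) \<and> (\<lambda>n. norm (Rq A q (\<phi> n))) \<longlonglongrightarrow> 0}"

definition surj_S_spectrum :: "('v::quat_hilbert \<Rightarrow> 'v) \<Rightarrow> quat set" where
  "surj_S_spectrum A = {q. range (Rq A q) \<noteq> UNIV}"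

definition kato_S_resolvent :: "('v::quat_hilbert \<Rightarrow> 'v) \<Rightarrow> quat set" where
  "kato_S_resolvent A =
    {q. closed (range (Rq A q)) \<and> {x. Rq A q x = 0} \<subseteq> (\<Inter>n::nat. range (Rq A q ^^ n))}"

definition kato_S_spectrum :: "('v::quat_hilbert \<Rightarrow> 'v) \<Rightarrow> quat set" where
  "kato_S_spectrum A = - kato_S_resolvent A"


section \<open>Slice regularity and the single-valued extension property\<close>

definition imag_units :: "quat set" where
  "imag_units = {I. I\<^sup>2 = - 1}"

text \<open>
  A function on \<open>U\<close> is a total function of which only the values on \<open>U\<close> matter. In the second
  clause \<open>fx\<close> and \<open>fy\<close> are the partial derivatives of the restriction of \<open>f\<close> to \<open>U \<inter> L\<^sub>I\<close>, in the
  real coordinates \<open>(x, y) \<mapsto> x + y I\<close> of the plane \<open>L\<^sub>I\<close>; they are determined on this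
  set, which is relatively open.
\<close>

definition right_slice_regular_on :: "quat set \<Rightarrow> (quat \<Rightarrow> 'v::quat_hilbert) \<Rightarrow> bool" where
  "right_slice_regular_on U f \<longleftrightarrow>
     open U \<and> f differentiable_on U \<and>
     (\<forall>I\<in>imag_units. \<exists>fx fy :: real \<times> real \<Rightarrow> 'v.
        let W = {(x, y). of_real x + y *\<^sub>R I \<in> U} in
          continuous_on W fx \<and> continuous_on W fy \<and>
          (\<forall>(x, y)\<in>W.
             ((\<lambda>s. f (of_real s + y *\<^sub>R I)) has_vector_derivative fx (x, y)) (at x) \<and>
             ((\<lambda>t. f (of_real x + t *\<^sub>R I)) has_vector_derivative fy (x, y)) (at y) \<and>
             fx (x, y) + fy (x, y) *\<^sub>H I = 0))"

definition SVEP_at :: "('v::quat_hilbert \<Rightarrow> 'v) \<Rightarrow> quat \<Rightarrow> bool" where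
  "SVEP_at A q0 \<longleftrightarrow>
     (\<forall>U f. open U \<and> q0 \<in> U \<and> continuous_on U f \<and> right_slice_regular_on U f \<and>
            (\<forall>q\<in>U. Rq A q (f q) = 0)
        \<longrightarrow> (\<forall>q\<in>U. f q = 0))"

definition SVEP :: "('v::quat_hilbert \<Rightarrow> 'v) \<Rightarrow> bool" where
  "SVEP A \<longleftrightarrow> (\<forall>q. SVEP_at A q)"

end

theory Submission
  imports Defs
begin

text \<open>
  Fix \<open>q\<^sub>0\<close>, put \<open>T = Rq A q\<^sub>0\<close> and suppose that \<open>T\<close> is a Kato operator, that is, it has closed
  range and \<open>ker T\<close> lies in the range of every power of \<open>T\<close>. All three parts follow from two facts:
  if \<open>A\<close> has SVEP, then \<open>T\<close> is injective (\<open>kato_point_trivial_kernel\<close>), and if \<open>A\<^sup>\<dagger>\<close> has SVEP, then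
  \<open>T\<close> is onto (\<open>kato_point_surjective\<close>). Indeed an injective operator with closed range is bounded
  below, which says that \<open>q\<^sub>0\<close> is not in the approximate spectrum; an operator that is onto and
  bounded below has a bounded inverse; and, conversely, operators that are bounded below or onto
  are trivially Kato operators.

  For injectivity, a nonzero \<open>w\<^sub>0 \<in> ker T\<close> is turned into a nonzero slice-regular \<open>f\<close> with
  \<open>Rq A q (f q) = 0\<close>. The Kato condition gives a chain \<open>T w\<^sub>n\<^sub>+\<^sub>1 = w\<^sub>n\<close>, and closedness of the range
  (through the open mapping theorem) keeps its growth geometric. Let
  \<open>Q(q) = q\<^sup>2 - 2 Re(q\<^sub>0) q + |q\<^sub>0|\<^sup>2\<close>, the real polynomial that vanishes on the sphere of \<open>q\<^sub>0\<close>, so that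
  \<open>T = Q(A)\<close>. Near that sphere \<open>g(q) = \<Sum>\<^sub>n w\<^sub>n Q(q)\<^sup>n\<close> converges and satisfies \<open>Q(A) g(q) = g(q) Q(q)\<close>.
  Right multiplication by \<open>q\<close>, written \<open>R\<close>, commutes with \<open>A\<close>, and
  \<open>Q(A) - Q(R) = (A - R) (A + R - 2 Re(q\<^sub>0))\<close>; hence \<open>f = (A + R - 2 Re(q\<^sub>0)) g\<close> satisfies
  \<open>A f(q) = f(q) q\<close>, and then \<open>Rq A q (f q) = 0\<close>. By SVEP \<open>f\<close> vanishes. The points \<open>q = x + y I\<close> and
  \<open>x - y I\<close> with \<open>x = Re(q\<^sub>0)\<close> have the same real value \<open>Q(q)\<close>, so the difference of the two values
  of \<open>f\<close> is \<open>g(q) (2 y I)\<close>; thus \<open>g\<close> vanishes arbitrarily close to the sphere and \<open>w\<^sub>0 = 0\<close>. Because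
  the expansion is in powers of \<open>Q\<close> and not of \<open>q - q\<^sub>0\<close>, real and nonreal \<open>q\<^sub>0\<close> need no separate
  treatment, and the domain is symmetric enough to contain both points. This is
  \<open>SVEP_imp_trivial_kernel\<close>.

  For surjectivity the same result is applied to \<open>A\<^sup>\<dagger>\<close> and \<open>T\<^sup>\<dagger>\<close>. Its hypotheses are stated in the
  form that passes to adjoints: bounded preimages, and \<open>ker T\<^sup>n \<subseteq> ran T\<close> for all \<open>n\<close>. The first
  passes because a functional on \<open>ran T\<close> is represented by a vector (\<open>adjoint_bounded_preimages\<close>),
  which also shows \<open>ran T\<^sup>\<dagger> = (ker T)\<^sup>\<bottom>\<close>; the second because \<open>ker T \<subseteq> ran T\<^sup>n\<close> makes \<open>ker (T\<^sup>\<dagger>)\<^sup>n\<close>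
  orthogonal to \<open>ker T\<close>. So \<open>ker T\<^sup>\<dagger> = (ran T)\<^sup>\<bottom>\<close> is trivial and the closed range is everything.
\<close>

section \<open>Operators with closed range\<close>

text \<open>
  The Baire half of the open mapping theorem. The closed range is a complete metric space covered
  by the closures of the images of the balls \<open>cball 0 n\<close>; one of these has interior, and by taking
  differences a neighbourhood of the origin in the range is approximated by bounded preimages.
  Rescaling makes the error at most half of the norm.
\<close>

lemma closed_range_approx_preimages:
  fixes T :: "'a::real_normed_vector \<Rightarrow> 'b::banach"
  assumes T: "bounded_linear T" and cl: "closed (range T)"
  obtains K where "K > 0"
    "\<And>y. y \<in> range T \<Longrightarrow> \<exists>x. norm x \<le> K * norm y \<and> norm (y - T x) \<le> norm y / 2"
proof -
  interpret T: bounded_linear T by (rule T)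
  define E where "E n = closure (T ` cball 0 (real n))" for n
  have sub: "subspace (range T)"
    by (simp add: T.linear_axioms linear_subspace_image)
  have E_range: "E n \<subseteq> range T" for n
    unfolding E_def using cl by (metis closure_minimal image_mono subset_UNIV)
  have "\<Union> (range E) = range T"
  proof
    show "range T \<subseteq> \<Union> (range E)"
    proof clarify
      fix x :: 'a
      obtain n :: nat where "norm x \<le> real n" using real_arch_simple by blast
      then have "T x \<in> E n"
        unfolding E_def by (intro subsetD [OF closure_subset]) auto
      then show "T x \<in> \<Union> (range E)" by blast
    qed
  qed (use E_range in blast)
  moreover have "top_of_set (range T) interior_of range T = range T"
    by (metis interior_of_topspace topspace_euclidean_subtopology)
  moreover have "completely_metrizable_space (top_of_set (range T))"
    using cl closed_closedin completely_metrizable_space_closedin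
      completely_metrizable_space_euclidean by blast
  moreover have "closedin (top_of_set (range T)) (E n)" for n
    using E_range by (simp add: E_def closed_subset)
  ultimately obtain n where "top_of_set (range T) interior_of E n \<noteq> {}"
    using Baire_category_alt [of "top_of_set (range T)" "range E"] by fastforce
  then obtain y0 W where W: "openin (top_of_set (range T)) W" "W \<subseteq> E n" "y0 \<in> W"
    unfolding interior_of_def by blast
  then obtain r where r: "r > 0" "ball y0 r \<inter> range T \<subseteq> E n"
    by (metis openin_contains_ball subset_trans)
  have y0: "y0 \<in> range T" "y0 \<in> E n" using W E_range by auto
  \<comment> \<open>Subtracting approximations of \<open>y0 + y\<close> and \<open>y0\<close> moves the interior point to the origin; this
    doubles the bound.\<close>
  have approx: "\<exists>x. norm x \<le> 2 * real n \<and> norm (y - T x) < e"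
    if y: "y \<in> range T" "norm y < r" and e: "e > 0" for y e
  proof -
    have "y0 + y \<in> ball y0 r \<inter> range T"
      using y y0 sub by (auto simp: dist_norm intro: subspace_add)
    then have "y0 + y \<in> E n" using r by blast
    then obtain a where a: "norm a \<le> real n" "dist (T a) (y0 + y) < e / 2"
      unfolding E_def closure_approachable using e by (metis half_gt_zero imageE mem_cball_0)
    obtain b where b: "norm b \<le> real n" "dist (T b) y0 < e / 2"
      using y0(2) e unfolding E_def closure_approachable by (metis half_gt_zero imageE mem_cball_0)
    have "y - T (a - b) = (T b - y0) - (T a - (y0 + y))"
      by (simp add: T.diff)
    then have "norm (y - T (a - b)) \<le> norm (T b - y0) + norm (T a - (y0 + y))"
      using norm_triangle_ineq4 by metis
    then have "norm (y - T (a - b)) < e"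
      using a(2) b(2) unfolding dist_norm by linarith
    moreover have "norm (a - b) \<le> 2 * real n"
      using a(1) b(1) norm_triangle_ineq4 [of a b] by linarith
    ultimately show ?thesis by blast
  qed
  \<comment> \<open>Vectors are rescaled to norm \<open>r / 2\<close>, hence the factor 4; adding 1 keeps \<open>K\<close> positive if \<open>n = 0\<close>.\<close>
  define K where "K = 4 * real n / r + 1"
  show thesis
  proof
    show "K > 0" using r(1) by (simp add: K_def add_nonneg_pos)
    fix y assume y: "y \<in> range T"
    show "\<exists>x. norm x \<le> K * norm y \<and> norm (y - T x) \<le> norm y / 2"
    proof (cases "y = 0")
      case True
      then show ?thesis by (intro exI [of _ 0]) (simp add: T.zero)
    next
      case False
      define c where "c = r / (2 * norm y)"
      have c: "c > 0" using r False by (simp add: c_def)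
      have "norm (c *\<^sub>R y) = r / 2" using r(1) False by (simp add: c_def)
      then have "norm (c *\<^sub>R y) < r" using r by simp
      moreover have "c *\<^sub>R y \<in> range T" using y sub by (simp add: subspace_scale)
      moreover have "c * norm y / 2 > 0" using c False by simp
      ultimately obtain x where x: "norm x \<le> 2 * real n" "norm (c *\<^sub>R y - T x) < c * norm y / 2"
        using approx by blast
      have "norm (x /\<^sub>R c) \<le> 2 * real n / c"
        using x(1) c by (simp add: divide_simps)
      also have "\<dots> \<le> K * norm y"
        using r False by (simp add: c_def K_def field_simps)
      finally have 1: "norm (x /\<^sub>R c) \<le> K * norm y" .
      have "c * norm (y - T (x /\<^sub>R c)) = norm (c *\<^sub>R (y - T (x /\<^sub>R c)))"
        using c by simp
      also have "\<dots> = norm (c *\<^sub>R y - T x)"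
        using c by (simp add: T.scaleR scaleR_right_diff_distrib)
      also have "\<dots> \<le> c * (norm y / 2)" using x(2) by simp
      finally have "norm (y - T (x /\<^sub>R c)) \<le> norm y / 2"
        using c by (simp add: mult_le_cancel_left_pos)
      with 1 show ?thesis by blast
    qed
  qed
qed

text \<open>
  The completeness half of the open mapping theorem: the remaining error is approximated again and
  again, and the corrections sum to an exact preimage since they decay geometrically.
\<close>

lemma closed_range_bounded_preimages:
  fixes T :: "'a::banach \<Rightarrow> 'b::banach"
  assumes T: "bounded_linear T" and cl: "closed (range T)"
  obtains C where "C > 0" "\<And>y. y \<in> range T \<Longrightarrow> \<exists>x. T x = y \<and> norm x \<le> C * norm y"
proof -
  interpret T: bounded_linear T by (rule T)
  obtain K where K: "K > 0"
    "\<And>y. y \<in> range T \<Longrightarrow> \<exists>x. norm x \<le> K * norm y \<and> norm (y - T x) \<le> norm y / 2"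
    using closed_range_approx_preimages [OF T cl] by blast
  then obtain s where s: "\<And>y. y \<in> range T \<Longrightarrow> norm (s y) \<le> K * norm y"
      "\<And>y. y \<in> range T \<Longrightarrow> norm (y - T (s y)) \<le> norm y / 2"
    by metis
  show thesis
  proof
    show "2 * K > 0" using K by simp
    fix y assume y: "y \<in> range T"
    define z where "z n = ((\<lambda>v. v - T (s v)) ^^ n) y" for n
    have z0: "z 0 = y" and zSuc: "z (Suc n) = z n - T (s (z n))" for n
      by (simp_all add: z_def)
    have z: "z n \<in> range T \<and> norm (z n) \<le> norm y * (1/2) ^ n" for n
    proof (induction n)
      case (Suc n)
      then have "norm (z (Suc n)) \<le> norm (z n) / 2" using s by (simp add: zSuc)
      moreover have "z (Suc n) \<in> range T"
        using Suc by (auto simp: zSuc T.diff [symmetric])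
      ultimately show ?case using Suc by simp
    qed (simp add: z0 y)
    have le: "norm (s (z n)) \<le> K * norm y * (1/2) ^ n" for n
    proof -
      have "norm (s (z n)) \<le> K * norm (z n)" using s z by blast
      also have "\<dots> \<le> K * (norm y * (1/2) ^ n)" using K z by (intro mult_left_mono) auto
      finally show ?thesis by simp
    qed
    have geo: "summable (\<lambda>n. K * norm y * (1/2::real) ^ n)"
      by (intro summable_mult summable_geometric) simp
    then have sm: "summable (\<lambda>n. s (z n))"
      using le by (rule summable_comparison_test')
    have "(\<lambda>n. norm y * (1/2::real) ^ n) \<longlonglongrightarrow> 0"
      by (intro tendsto_mult_right_zero LIMSEQ_realpow_zero) auto
    then have "z \<longlonglongrightarrow> 0"
      by (rule Lim_null_comparison [rotated]) (use z in auto)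
    then have "(\<lambda>n. z n - z (Suc n)) sums (z 0 - 0)"
      by (rule telescope_sums')
    then have "(\<lambda>n. T (s (z n))) sums y"
      by (simp add: zSuc z0)
    then have "T (\<Sum>n. s (z n)) = y"
      using T.sums [OF summable_sums [OF sm]] sums_unique2 by blast
    moreover have "norm (\<Sum>n. s (z n)) \<le> (\<Sum>n. K * norm y * (1/2) ^ n)"
      by (rule norm_suminf_le [OF le geo])
    moreover have "(\<Sum>n. K * norm y * (1/2::real) ^ n) = 2 * K * norm y"
      by (subst suminf_mult) (auto simp: suminf_geometric)
    ultimately show "\<exists>x. T x = y \<and> norm x \<le> 2 * K * norm y" by auto
  qed
qed

lemma bounded_below_closed_range:
  fixes T :: "'a::banach \<Rightarrow> 'b::banach"
  assumes T: "bounded_linear T" and c: "c > 0" and below: "\<And>x. c * norm x \<le> norm (T x)"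
  shows "closed (range T)"
proof -
  interpret T: bounded_linear T by (rule T)
  have "complete (range T)"
    by (rule complete_isometric_image [OF c _ T])
       (use below complete_UNIV in \<open>auto simp: mult.commute\<close>)
  then show ?thesis by (rule complete_imp_closed)
qed

section \<open>Orthogonality and adjoints\<close>

lemma norm_scaleQ: "norm (x *\<^sub>H q) = norm x * norm q"
  for x :: "'v::quat_hilbert"
proof -
  have "of_real ((norm (x *\<^sub>H q))\<^sup>2) = qcnj q * (of_real ((norm x)\<^sup>2) * q)"
    by (simp only: qinner_self [symmetric] qinner_scaleQ_left qinner_scaleQ_right mult.assoc)
  also have "\<dots> = of_real ((norm x)\<^sup>2) * (qcnj q * q)"
    by (simp add: of_real_def)
  also have "\<dots> = of_real ((norm x * norm q)\<^sup>2)"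
    by (simp add: qcnj_times_self of_real_def power_mult_distrib)
  finally have "(norm (x *\<^sub>H q))\<^sup>2 = (norm x * norm q)\<^sup>2"
    using of_real_eq_iff by blast
  then show ?thesis by (rule power2_eq_imp_eq) simp_all
qed

lemma scaleR_scaleQ: "(r *\<^sub>R x) *\<^sub>H q = r *\<^sub>R (x *\<^sub>H q)"
  and scaleQ_scaleR: "x *\<^sub>H (r *\<^sub>R q) = r *\<^sub>R (x *\<^sub>H q)"
  for x :: "'v::quat_hilbert"
proof -
  have "of_real r * q = r *\<^sub>R q" "q * of_real r = r *\<^sub>R q"
    by (simp_all add: of_real_def)
  then show "(r *\<^sub>R x) *\<^sub>H q = r *\<^sub>R (x *\<^sub>H q)" "x *\<^sub>H (r *\<^sub>R q) = r *\<^sub>R (x *\<^sub>H q)"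
    using scaleQ_scaleQ [of x "of_real r" q] scaleQ_scaleQ [of x q "of_real r"]
    by (simp_all only: scaleQ_of_real)
qed

lemma scaleQ_one [simp]: "x *\<^sub>H 1 = x"
  for x :: "'v::quat_hilbert"
  using scaleQ_of_real [of x 1] by simp

lemma bounded_bilinear_scaleQ: "bounded_bilinear ((*\<^sub>H) :: 'v::quat_hilbert \<Rightarrow> quat \<Rightarrow> 'v)"
proof
  show "\<exists>K. \<forall>(x::'v) q. norm (x *\<^sub>H q) \<le> norm x * norm q * K"
    by (intro exI [of _ 1]) (simp add: norm_scaleQ)
qed (simp_all only: scaleQ_add_left scaleQ_add_right scaleR_scaleQ scaleQ_scaleR)

interpretation scaleQ: bounded_bilinear "(*\<^sub>H) :: 'v::quat_hilbert \<Rightarrow> quat \<Rightarrow> 'v"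
  by (rule bounded_bilinear_scaleQ)

definition rinner :: "'v::quat_hilbert \<Rightarrow> 'v \<Rightarrow> real" where
  "rinner x y = qRe (qinner x y)"

lemma rinner_commute: "rinner x y = rinner y x"
  using qcnj_sel(1) [of "qinner x y"] unfolding rinner_def qinner_conj by (rule sym)

lemma rinner_add_right: "rinner x (y + z) = rinner x y + rinner x z"
  by (simp add: rinner_def qinner_add_right)

lemma rinner_scaleR_right: "rinner x (r *\<^sub>R y) = r * rinner x y"
proof -
  have "qinner x (r *\<^sub>R y) = qinner x y * of_real r"
    using qinner_scaleQ_right [of x y "of_real r"] by (simp only: scaleQ_of_real)
  then show ?thesis by (simp add: rinner_def)
qed

lemma rinner_add_left: "rinner (x + y) z = rinner x z + rinner y z"
  unfolding rinner_commute [where y = z] by (rule rinner_add_right)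

lemma rinner_scaleR_left: "rinner (r *\<^sub>R x) y = r * rinner x y"
  unfolding rinner_commute [where y = y] by (rule rinner_scaleR_right)

lemma rinner_diff_right: "rinner x (y - z) = rinner x y - rinner x z"
  using rinner_add_right [of x "y - z" z] unfolding diff_add_cancel by linarith

lemma rinner_diff_left: "rinner (x - y) z = rinner x z - rinner y z"
  unfolding rinner_commute [where y = z] by (rule rinner_diff_right)

lemma rinner_self: "rinner x x = (norm x)\<^sup>2"
  unfolding rinner_def qinner_self by (rule quat_sel_of_real)

text \<open>
  The norm already satisfies the triangle inequality, so the Cauchy--Schwarz inequality is read off
  from the expansion of \<open>\<parallel>x + y\<parallel>\<^sup>2 \<le> (\<parallel>x\<parallel> + \<parallel>y\<parallel>)\<^sup>2\<close>.
\<close>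

lemma rinner_le_norm: "\<bar>rinner x y\<bar> \<le> norm x * norm y"
proof -
  have "rinner x y \<le> norm x * norm y" for x y :: 'a
  proof -
    have "(norm (x + y))\<^sup>2 \<le> (norm x + norm y)\<^sup>2"
      by (simp add: norm_triangle_ineq power_mono)
    then show ?thesis
      unfolding power2_sum rinner_self [symmetric] rinner_add_left rinner_add_right
      using rinner_commute [of x y] by simp
  qed
  from this [of x y] this [of x "(-1) *\<^sub>R y"] show ?thesis
    unfolding rinner_scaleR_right by (simp add: abs_le_iff)
qed

lemma rinner_eq_imp_eq:
  assumes "\<And>z. rinner x z = rinner y z"
  shows "x = y"
proof -
  have "rinner (x - y) (x - y) = 0" using assms by (simp add: rinner_diff_left)
  then show ?thesis by (simp add: rinner_self)
qed

lemma parallelogram: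
  "(norm (u - v))\<^sup>2 = 2 * (norm u)\<^sup>2 + 2 * (norm v)\<^sup>2 - 4 * (norm ((1/2) *\<^sub>R (u + v)))\<^sup>2"
  for u :: "'v::quat_hilbert"
  unfolding rinner_self [symmetric] rinner_diff_left rinner_diff_right rinner_add_left
    rinner_add_right rinner_scaleR_left rinner_scaleR_right rinner_commute [of v u]
  by (simp add: field_simps)

text \<open>
  The representing vector minimises \<open>F u = \<parallel>u\<parallel>\<^sup>2 - 2 \<phi> u\<close> on the subspace: the parallelogram law makes
  minimising sequences Cauchy, and the first variation of \<open>F\<close> at the minimum is the claim. Only the
  real part of the inner product is involved, so one argument covers the existence of adjoints (on
  the whole space), preimages under adjoints, and orthogonal projections (on closed ranges).
\<close>

lemma riesz_closed_subspace:
  fixes M :: "'v::quat_hilbert set" and \<phi> :: "'v \<Rightarrow> real"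
  assumes M: "subspace M" "closed M"
    and add: "\<And>x y. x \<in> M \<Longrightarrow> y \<in> M \<Longrightarrow> \<phi> (x + y) = \<phi> x + \<phi> y"
    and scale: "\<And>r x. x \<in> M \<Longrightarrow> \<phi> (r *\<^sub>R x) = r * \<phi> x"
    and bound: "\<And>x. x \<in> M \<Longrightarrow> \<bar>\<phi> x\<bar> \<le> K * norm x"
  obtains u where "u \<in> M" "\<And>x. x \<in> M \<Longrightarrow> \<phi> x = rinner u x"
proof -
  define F where "F u = (norm u)\<^sup>2 - 2 * \<phi> u" for u
  define m where "m = Inf (F ` M)"
  have "- K\<^sup>2 \<le> F u" if "u \<in> M" for u
  proof -
    have "0 \<le> (norm u - K)\<^sup>2" by simp
    then show ?thesis using bound [OF that] by (simp add: F_def power2_diff mult.commute)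
  qed
  then have bdd: "bdd_below (F ` M)" unfolding bdd_below_def by blast
  have ne: "F ` M \<noteq> {}" using M(1) subspace_0 by blast
  have m_le: "m \<le> F u" if "u \<in> M" for u
    unfolding m_def using bdd that by (auto intro: cInf_lower)
  have "\<exists>u\<in>M. F u < m + 1 / real (Suc n)" for n
    using cInf_lessD [OF ne, of "m + 1 / real (Suc n)"] by (auto simp: m_def)
  then obtain u where u: "\<And>n. u n \<in> M" "\<And>n. F (u n) < m + 1 / real (Suc n)" by metis
  have F_par: "(norm (a - b))\<^sup>2 \<le> 2 * (F a - m) + 2 * (F b - m)" if "a \<in> M" "b \<in> M" for a b
  proof -
    have ab: "a + b \<in> M" using that M(1) subspace_add by blast
    define N where "N = (norm ((1/2) *\<^sub>R (a + b)))\<^sup>2"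
    have "m \<le> F ((1/2) *\<^sub>R (a + b))" using ab M(1) by (intro m_le subspace_scale)
    then have "m \<le> N - (\<phi> a + \<phi> b)"
      unfolding F_def scale [OF ab] add [OF that] N_def [symmetric] by (simp add: field_simps)
    then show ?thesis
      unfolding F_def parallelogram [of a b] N_def [symmetric] by simp
  qed
  have "Cauchy u"
  proof (rule metric_CauchyI)
    fix e :: real assume e: "e > 0"
    then obtain N where N: "4 / real (Suc N) < e\<^sup>2"
      using reals_Archimedean [of "e\<^sup>2 / 4"] by (auto simp: field_simps)
    have "dist (u i) (u j) < e" if "i \<ge> N" "j \<ge> N" for i j
    proof -
      have "(norm (u i - u j))\<^sup>2 \<le> 2 * (F (u i) - m) + 2 * (F (u j) - m)"
        using F_par u by blast
      also have "\<dots> < 2 * (1 / real (Suc i)) + 2 * (1 / real (Suc j))"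
        using u(2) [of i] u(2) [of j] by simp
      also have "\<dots> \<le> 2 * (1 / real (Suc N)) + 2 * (1 / real (Suc N))"
        using that by (intro add_mono mult_left_mono divide_left_mono) auto
      also have "\<dots> < e\<^sup>2" using N by simp
      finally show ?thesis using e by (simp add: dist_norm power_less_imp_less_base)
    qed
    then show "\<exists>N. \<forall>i\<ge>N. \<forall>j\<ge>N. dist (u i) (u j) < e" by blast
  qed
  then obtain l where l: "u \<longlonglongrightarrow> l" using Cauchy_convergent convergent_def by blast
  have lM: "l \<in> M" using closed_sequentially [OF M(2) _ l] u(1) by blast
  have "(\<lambda>n. \<phi> (u n)) \<longlonglongrightarrow> \<phi> l"
  proof (rule LIM_zero_cancel, rule Lim_null_comparison)
    have "\<phi> (u n) - \<phi> l = \<phi> (u n - l)" for n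
      using add [of "u n" "(-1) *\<^sub>R l"] scale [OF lM, of "-1"] u(1) lM M(1)
      by (auto simp: subspace_neg)
    then show "\<forall>\<^sub>F n in sequentially. norm (\<phi> (u n) - \<phi> l) \<le> K * norm (u n - l)"
      using bound u(1) lM M(1) by (simp add: subspace_diff)
    show "(\<lambda>n. K * norm (u n - l)) \<longlonglongrightarrow> 0"
      using tendsto_mult_right_zero LIM_zero [OF l] tendsto_norm_zero by blast
  qed
  then have "(\<lambda>n. F (u n)) \<longlonglongrightarrow> F l"
    unfolding F_def by (intro tendsto_intros l)
  moreover have "(\<lambda>n. m + 1 / real (Suc n)) \<longlonglongrightarrow> m + 0"
    by (intro tendsto_intros LIMSEQ_Suc [OF lim_1_over_n])
  ultimately have "F l \<le> m"
    using LIMSEQ_le u(2) less_imp_le by (metis (no_types, lifting) add.right_neutral)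
  have "\<phi> x = rinner l x" if x: "x \<in> M" for x
  proof -
    define d where "d = rinner l x - \<phi> x"
    have "0 \<le> 2 * t * d + t\<^sup>2 * (norm x)\<^sup>2" for t
    proof -
      have tx: "t *\<^sub>R x \<in> M" using x M(1) by (rule subspace_scale [rotated])
      have "F l \<le> F (l + t *\<^sub>R x)"
        using \<open>F l \<le> m\<close> m_le [OF subspace_add [OF M(1) lM tx]] by linarith
      then show ?thesis
        unfolding F_def d_def add [OF lM tx] scale [OF x] rinner_self [symmetric] rinner_add_left
          rinner_add_right rinner_scaleR_left rinner_scaleR_right rinner_commute [of x l]
        by (simp add: power2_eq_square algebra_simps)
    qed
    then have pos: "0 \<le> 2 * t * d + t\<^sup>2 * (norm x)\<^sup>2" for t .
    \<comment> \<open>At \<open>t = - d / s\<close> the linear term wins, which leaves only \<open>d = 0\<close>.\<close>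
    define s where "s = 1 + (norm x)\<^sup>2"
    have s: "s > 0" by (simp add: s_def add_pos_nonneg)
    have norm_x: "(norm x)\<^sup>2 = s - 1" by (simp add: s_def)
    have "0 \<le> s\<^sup>2 * (2 * (- d / s) * d + (- d / s)\<^sup>2 * (s - 1))"
      using pos [of "- d / s"] unfolding norm_x by (intro mult_nonneg_nonneg) auto
    also have "\<dots> = - (d\<^sup>2 * (s + 1))"
      using s by (simp add: power2_eq_square field_simps)
    finally have "d\<^sup>2 * (s + 1) \<le> 0" by simp
    then have "d\<^sup>2 \<le> 0" using s by (simp add: mult_le_0_iff)
    then show ?thesis by (simp add: d_def)
  qed
  with lM show thesis by (rule that)
qed

text \<open>
  Together with right linearity this recovers the quaternionic inner product from its real part,
  the imaginary coordinates being the real parts of the products with the units.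
\<close>

lemma qRe_mult_eq_imp_eq:
  assumes "\<And>q. qRe (a * q) = qRe (b * q)"
  shows "a = b"
  using assms [of 1] assms [of "Quat 0 1 0 0"] assms [of "Quat 0 0 1 0"] assms [of "Quat 0 0 0 1"]
  by (simp add: quat_eq_iff)

lemma rinner_scaleQ_right: "rinner x (y *\<^sub>H q) = qRe (qinner x y * q)"
  by (simp only: rinner_def qinner_scaleQ_right)

lemma adjoint_exists:
  fixes A :: "'v::quat_hilbert \<Rightarrow> 'v"
  assumes A: "bounded_qlinear A"
  obtains B where "bounded_qlinear B" "\<And>x y. qinner x (A y) = qinner (B x) y"
proof -
  interpret A: bounded_linear A using A by (simp add: bounded_qlinear_def)
  have AQ: "A (x *\<^sub>H q) = A x *\<^sub>H q" for x q using A by (simp add: bounded_qlinear_def)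
  obtain K where K: "K > 0" "\<And>x. norm (A x) \<le> norm x * K" using A.pos_bounded by blast
  have rA: "\<bar>rinner x (A y)\<bar> \<le> norm x * K * norm y" for x y
  proof -
    have "\<bar>rinner x (A y)\<bar> \<le> norm x * norm (A y)" by (rule rinner_le_norm)
    also have "\<dots> \<le> norm x * (norm y * K)" using K(2) by (intro mult_left_mono) auto
    finally show ?thesis by (simp add: mult_ac)
  qed
  have "\<exists>b. \<forall>y. rinner x (A y) = rinner b y" for x
    by (rule riesz_closed_subspace [of UNIV "\<lambda>y. rinner x (A y)"])
      (use rA in \<open>auto simp: A.add A.scaleR rinner_add_right rinner_scaleR_right\<close>)
  then obtain B where B: "\<And>x y. rinner x (A y) = rinner (B x) y" by metis
  have BQ: "qinner x (A y) = qinner (B x) y" for x y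
  proof (rule qRe_mult_eq_imp_eq)
    fix q
    show "qRe (qinner x (A y) * q) = qRe (qinner (B x) y * q)"
      unfolding rinner_scaleQ_right [symmetric] AQ [symmetric] by (rule B)
  qed
  have "bounded_linear B"
  proof (rule bounded_linear_intro)
    show "B (x + y) = B x + B y" for x y
      by (rule rinner_eq_imp_eq) (simp only: rinner_add_left B [symmetric])
    show "B (r *\<^sub>R x) = r *\<^sub>R B x" for r x
      by (rule rinner_eq_imp_eq) (simp only: rinner_scaleR_left B [symmetric])
    show "norm (B x) \<le> norm x * K" for x
    proof (cases "B x = 0")
      case False
      have "(norm (B x))\<^sup>2 \<le> norm x * K * norm (B x)"
        using rA [of x "B x"] B [of x "B x"] by (simp add: rinner_self)
      then show ?thesis using False by (simp add: power2_eq_square)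
    qed (use K in simp)
  qed
  moreover have "B (x *\<^sub>H q) = B x *\<^sub>H q" for x q
    by (rule rinner_eq_imp_eq) (simp only: rinner_def qinner_scaleQ_left BQ [symmetric])
  ultimately have "bounded_qlinear B" by (simp add: bounded_qlinear_def)
  with BQ show thesis using that by blast
qed

lemma qadjoint:
  assumes "bounded_qlinear A"
  shows bounded_qlinear_qadjoint: "bounded_qlinear (qadjoint A)"
    and rinner_qadjoint: "rinner x (A y) = rinner (qadjoint A x) y"
proof -
  have "\<exists>!B. bounded_qlinear B \<and> (\<forall>x y. qinner x (A y) = qinner (B x) y)"
  proof (rule ex_ex1I)
    show "\<exists>B. bounded_qlinear B \<and> (\<forall>x y. qinner x (A y) = qinner (B x) y)"
      by (rule adjoint_exists [OF assms]) blast
  next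
    fix B B'
    assume "bounded_qlinear B \<and> (\<forall>x y. qinner x (A y) = qinner (B x) y)"
      and "bounded_qlinear B' \<and> (\<forall>x y. qinner x (A y) = qinner (B' x) y)"
    then have "rinner (B x) y = rinner (B' x) y" for x y by (simp add: rinner_def)
    then show "B = B'" by (intro ext rinner_eq_imp_eq)
  qed
  note spec = theI' [OF this, folded qadjoint_def]
  show "bounded_qlinear (qadjoint A)" by (rule conjunct1 [OF spec])
  have "qinner x (A y) = qinner (qadjoint A x) y" using conjunct2 [OF spec] by blast
  then show "rinner x (A y) = rinner (qadjoint A x) y" unfolding rinner_def by (rule arg_cong)
qed

lemma bounded_qlinear_Rq:
  assumes A: "bounded_qlinear A"
  shows "bounded_qlinear (Rq A q)"
proof -
  have bl: "bounded_linear A" and AQ: "\<And>x p. A (x *\<^sub>H p) = A x *\<^sub>H p"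
    using A by (simp_all add: bounded_qlinear_def)
  have "bounded_linear (Rq A q)"
    unfolding Rq_def
    by (intro bounded_linear_add bounded_linear_sub bounded_linear_compose [OF bl]
        bounded_linear_const_scaleR bl bounded_linear_ident)
  moreover have "Rq A q (x *\<^sub>H p) = Rq A q x *\<^sub>H p" for x p
    by (simp only: Rq_def AQ scaleQ.add_left scaleQ.diff_left scaleQ.scaleR_left)
  ultimately show ?thesis by (simp add: bounded_qlinear_def)
qed

lemma rinner_Rq_qadjoint:
  assumes "bounded_qlinear A"
  shows "rinner x (Rq A q y) = rinner (Rq (qadjoint A) q x) y"
proof -
  have "rinner x (A (A y)) = rinner (qadjoint A (qadjoint A x)) y"
    "rinner x (A y) = rinner (qadjoint A x) y"
    by (rule trans; rule rinner_qadjoint [OF assms]) (rule rinner_qadjoint [OF assms])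
  then show ?thesis
    by (simp only: Rq_def rinner_add_left rinner_add_right rinner_diff_left rinner_diff_right
        rinner_scaleR_left rinner_scaleR_right)
qed

text \<open>
  Vectors \<open>y\<close> orthogonal to \<open>ker T\<close> induce a well-defined functional \<open>T x \<mapsto> \<langle>y, x\<rangle>\<close> on the range of
  \<open>T\<close>, bounded by \<open>C \<parallel>y\<parallel>\<close> since preimages can be chosen small. The vector \<open>u\<close> that represents it
  satisfies \<open>\<langle>S u, x\<rangle> = \<langle>u, T x\<rangle> = \<langle>y, x\<rangle>\<close>, and \<open>\<parallel>u\<parallel>\<close> obeys the same bound.
\<close>

lemma adjoint_bounded_preimages:
  fixes T S :: "'v::quat_hilbert \<Rightarrow> 'v"
  assumes T: "bounded_linear T" and cl: "closed (range T)"
    and adj: "\<And>x y. rinner x (T y) = rinner (S x) y"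
    and C: "C > 0" "\<And>y. y \<in> range T \<Longrightarrow> \<exists>x. T x = y \<and> norm x \<le> C * norm y"
    and y: "\<And>x. T x = 0 \<Longrightarrow> rinner y x = 0"
  shows "\<exists>u. S u = y \<and> norm u \<le> C * norm y"
proof -
  interpret T: bounded_linear T by (rule T)
  obtain s where s: "\<And>z. z \<in> range T \<Longrightarrow> T (s z) = z" "\<And>z. z \<in> range T \<Longrightarrow> norm (s z) \<le> C * norm z"
    using C(2) by metis
  have sub: "subspace (range T)"
    by (simp add: T.linear_axioms linear_subspace_image)
  have eq: "rinner y a = rinner y b" if "T a = T b" for a b
    using y [of "a - b"] that by (simp add: T.diff rinner_diff_right)
  have bound: "\<bar>rinner y (s z)\<bar> \<le> norm y * C * norm z" if "z \<in> range T" for z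
  proof -
    have "\<bar>rinner y (s z)\<bar> \<le> norm y * norm (s z)" by (rule rinner_le_norm)
    also have "\<dots> \<le> norm y * (C * norm z)" using s(2) [OF that] by (intro mult_left_mono) auto
    finally show ?thesis by (simp add: mult_ac)
  qed
  obtain u where u: "u \<in> range T" "\<And>z. z \<in> range T \<Longrightarrow> rinner y (s z) = rinner u z"
  proof (rule riesz_closed_subspace [of "range T" "\<lambda>z. rinner y (s z)" "norm y * C"])
    fix a b assume ab: "a \<in> range T" "b \<in> range T"
    have "rinner y (s (a + b)) = rinner y (s a + s b)"
      using ab sub by (intro eq) (simp add: s T.add subspace_add)
    then show "rinner y (s (a + b)) = rinner y (s a) + rinner y (s b)"
      by (simp only: rinner_add_right)
  next
    fix r a assume a: "a \<in> range T"
    have "rinner y (s (r *\<^sub>R a)) = rinner y (r *\<^sub>R s a)"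
      using a sub by (intro eq) (simp add: s T.scaleR subspace_scale)
    then show "rinner y (s (r *\<^sub>R a)) = r * rinner y (s a)"
      by (simp only: rinner_scaleR_right)
  qed (use sub cl bound in auto)
  have "S u = y"
  proof (rule rinner_eq_imp_eq)
    fix x
    have "rinner y (s (T x)) = rinner y x" by (rule eq) (simp add: s)
    then show "rinner (S u) x = rinner y x" using u(2) [of "T x"] adj by simp
  qed
  moreover have "norm u \<le> C * norm y"
  proof (cases "u = 0")
    case False
    have "(norm u)\<^sup>2 \<le> norm y * C * norm u"
      using bound [OF u(1)] u(2) [OF u(1)] by (simp add: rinner_self)
    then show ?thesis using False by (simp add: power2_eq_square mult_ac)
  qed (use C in simp)
  ultimately show ?thesis by blast
qed

text \<open>
  The orthogonal projection \<open>p\<close> of \<open>v\<close> onto the range represents the functional \<open>\<langle>v, _\<rangle>\<close> there, and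
  \<open>v - p\<close> is orthogonal to the range.
\<close>

lemma closed_range_trivial_orthogonal_complement:
  fixes T :: "'v::quat_hilbert \<Rightarrow> 'v"
  assumes T: "bounded_linear T" and cl: "closed (range T)"
    and triv: "\<And>v. (\<And>x. rinner v (T x) = 0) \<Longrightarrow> v = 0"
  shows "range T = UNIV"
proof -
  interpret T: bounded_linear T by (rule T)
  have "v \<in> range T" for v
  proof -
    obtain p where p: "p \<in> range T" "\<And>z. z \<in> range T \<Longrightarrow> rinner v z = rinner p z"
      by (rule riesz_closed_subspace [of "range T" "rinner v" "norm v"])
        (use cl rinner_le_norm in \<open>auto simp: T.linear_axioms linear_subspace_image
          rinner_add_right rinner_scaleR_right\<close>)
    have "v - p = 0" by (rule triv) (simp add: rinner_diff_left p(2))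
    with p(1) show ?thesis by simp
  qed
  then show ?thesis by blast
qed

section \<open>Kernels and ranges of iterates\<close>

text \<open>
  Any preimage of an element of the hyperrange \<open>\<Inter>\<^sub>m ran T\<^sup>m\<close> is again in the hyperrange, because it
  differs from a preimage of the form \<open>T\<^sup>m u\<close> by an element of \<open>ker T\<close>. So the hyperrange contains
  the kernels of all powers once it contains \<open>ker T\<close>.
\<close>

lemma kernel_funpow_subset_range_funpow:
  fixes T :: "'a::real_vector \<Rightarrow> 'a"
  assumes T: "linear T" and ker: "\<And>m. {x. T x = 0} \<subseteq> range (T ^^ m)"
  shows "(T ^^ n) x = 0 \<Longrightarrow> x \<in> range (T ^^ m)"
proof (induction n arbitrary: x m)
  case 0
  have "(T ^^ m) 0 = 0" by (induction m) (simp_all add: linear_0 [OF T])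
  with 0 show ?case by (metis funpow_0 rangeI)
next
  case (Suc n)
  have lin: "linear (T ^^ m)"
    by (induction m) (simp_all only: funpow.simps linear_id linear_compose T)
  have "(T ^^ n) (T x) = 0" using Suc.prems by (simp add: funpow_swap1)
  then obtain u where "T x = (T ^^ Suc m) u" using Suc.IH by blast
  then have "T (x - (T ^^ m) u) = 0" by (simp add: linear_diff [OF T])
  then obtain v where "x - (T ^^ m) u = (T ^^ m) v" using ker by blast
  then have "x = (T ^^ m) (u + v)" by (simp add: linear_add [OF lin] algebra_simps)
  then show ?case by blast
qed

text \<open>
  The \<open>n\<close>-th term of a chain of preimages over \<open>ker T\<close> lies in \<open>ker T\<^sup>n\<^sup>+\<^sup>1\<close>, hence in the range, so
  the chain never breaks off. These terms become the coefficients of a convergent power series.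
\<close>

lemma bounded_chain_over_kernel:
  fixes T :: "'a::real_normed_vector \<Rightarrow> 'a"
  assumes C: "C > 0" "\<And>y. y \<in> range T \<Longrightarrow> \<exists>x. T x = y \<and> norm x \<le> C * norm y"
    and ker: "\<And>n. {x. (T ^^ n) x = 0} \<subseteq> range T" and w0: "T w0 = 0"
  obtains w where "w 0 = w0" "\<And>n. T (w (Suc n)) = w n" "\<And>n. norm (w n) \<le> norm w0 * C ^ n"
proof -
  obtain s where s: "\<And>z. z \<in> range T \<Longrightarrow> T (s z) = z" "\<And>z. z \<in> range T \<Longrightarrow> norm (s z) \<le> C * norm z"
    using C(2) by metis
  define w where "w n = (s ^^ n) w0" for n
  have Suc: "w (Suc n) = s (w n)" for n by (simp add: w_def)
  have w: "(T ^^ Suc n) (w n) = 0" for n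
  proof (induction n)
    case (Suc n)
    then have "w n \<in> range T" using ker by blast
    then have "T (w (Suc n)) = w n" by (simp add: \<open>w (Suc n) = s (w n)\<close> s)
    with Suc show ?case by (metis comp_apply funpow_Suc_right)
  qed (simp add: w_def w0)
  then have range: "w n \<in> range T" for n using ker by blast
  show thesis
  proof
    show "w 0 = w0" by (simp add: w_def)
    show "T (w (Suc n)) = w n" for n by (simp add: Suc s range)
    show "norm (w n) \<le> norm w0 * C ^ n" for n
    proof (induction n)
      case (Suc n)
      have "norm (w (Suc n)) \<le> C * norm (w n)" by (simp add: \<open>\<And>n. w (Suc n) = s (w n)\<close> s range)
      also have "\<dots> \<le> C * (norm w0 * C ^ n)" using Suc C by (intro mult_left_mono) auto
      finally show ?case by (simp add: mult_ac)
    qed (simp add: w_def)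
  qed
qed

section \<open>Derivatives along slices\<close>

text \<open>
  Differentiability in all four real directions, where in the directions commuting with \<open>q\<close> (those
  of every slice through \<open>q\<close>) the differential is right multiplication of one vector. This is the
  Cauchy--Riemann equation of all these slices at once, and unlike partial derivatives it is
  convenient for sums and compositions.
\<close>

definition has_slice_derivative :: "(quat \<Rightarrow> 'v::quat_hilbert) \<Rightarrow> 'v \<Rightarrow> quat \<Rightarrow> bool" where
  "has_slice_derivative f d q \<longleftrightarrow>
     (\<exists>F. (f has_derivative F) (at q) \<and> (\<forall>h. h * q = q * h \<longrightarrow> F h = d *\<^sub>H h))"

lemma has_slice_derivative_imp_isCont: "has_slice_derivative f d q \<Longrightarrow> isCont f q"
  unfolding has_slice_derivative_def using has_derivative_continuous by blast

lemma right_slice_regular_onI: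
  fixes f :: "quat \<Rightarrow> 'v::quat_hilbert"
  assumes U: "open U" and der: "\<And>q. q \<in> U \<Longrightarrow> has_slice_derivative f (d q) q"
    and cont: "continuous_on U d"
  shows "right_slice_regular_on U f"
  unfolding right_slice_regular_on_def
proof (intro conjI ballI)
  show "open U" by (rule U)
  show "f differentiable_on U"
    unfolding differentiable_on_def differentiable_def
    using der has_derivative_at_withinI unfolding has_slice_derivative_def by blast
  fix I assume I: "I \<in> imag_units"
  then have II: "I * I = - 1" by (simp add: imag_units_def power2_eq_square)
  define p where "p x y = of_real x + y *\<^sub>R I" for x y :: real
  define W where "W = {(x, y). p x y \<in> U}"
  have contW: "continuous_on W (\<lambda>(x, y). d (p x y))"
    unfolding case_prod_unfold
  proof (rule continuous_on_compose2 [OF cont])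
    show "continuous_on W (\<lambda>z. p (fst z) (snd z))"
      unfolding p_def by (intro continuous_intros)
  qed (auto simp: W_def)
  then have contW': "continuous_on W (\<lambda>(x, y). d (p x y) *\<^sub>H I)"
    unfolding case_prod_unfold by (intro scaleQ.continuous_on continuous_intros)
  have chain: "((\<lambda>s. f (\<gamma> s)) has_vector_derivative d (\<gamma> s) *\<^sub>H h) (at s)"
    if \<gamma>: "(\<gamma> has_vector_derivative h) (at s)" and s: "\<gamma> s \<in> U" and h: "h * \<gamma> s = \<gamma> s * h"
    for \<gamma> h s
  proof -
    obtain F where F: "(f has_derivative F) (at (\<gamma> s))" "F h = d (\<gamma> s) *\<^sub>H h"
      using der [OF s] h unfolding has_slice_derivative_def by blast
    have "((\<lambda>s. f (\<gamma> s)) has_derivative (\<lambda>t. F (t *\<^sub>R h))) (at s)"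
      using has_derivative_compose [OF \<gamma> [unfolded has_vector_derivative_def] F(1)] .
    then show ?thesis
      unfolding has_vector_derivative_def F(2) [symmetric]
      by (simp only: linear_scale [OF has_derivative_linear [OF F(1)]])
  qed
  have dx: "((\<lambda>s. f (p s y)) has_vector_derivative d (p x y)) (at x)" if "p x y \<in> U" for x y
  proof -
    have "((\<lambda>s. p s y) has_vector_derivative 1) (at x)"
      unfolding p_def of_real_def by (auto intro!: derivative_eq_intros)
    from chain [OF this that] show ?thesis by simp
  qed
  have dy: "((\<lambda>t. f (p x t)) has_vector_derivative d (p x y) *\<^sub>H I) (at y)" if "p x y \<in> U" for x y
  proof -
    have "((\<lambda>t. p x t) has_vector_derivative I) (at y)"
      unfolding p_def by (auto intro!: derivative_eq_intros)
    moreover have "I * p x y = p x y * I"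
      by (simp add: p_def of_real_def ring_distribs)
    ultimately show ?thesis using chain [of "p x" I y] that by simp
  qed
  have CR: "d (p x y) + (d (p x y) *\<^sub>H I) *\<^sub>H I = 0" for x y
    by (simp add: scaleQ_scaleQ II scaleQ.minus_right)
  show "\<exists>fx fy. let W = {(x, y). of_real x + y *\<^sub>R I \<in> U} in
      continuous_on W fx \<and> continuous_on W fy \<and>
      (\<forall>(x, y)\<in>W.
         ((\<lambda>s. f (of_real s + y *\<^sub>R I)) has_vector_derivative fx (x, y)) (at x) \<and>
         ((\<lambda>t. f (of_real x + t *\<^sub>R I)) has_vector_derivative fy (x, y)) (at y) \<and>
         fx (x, y) + fy (x, y) *\<^sub>H I = 0)"
    unfolding Let_def p_def [symmetric] W_def [symmetric]
    by (rule exI [of _ "\<lambda>(x, y). d (p x y)"], rule exI [of _ "\<lambda>(x, y). d (p x y) *\<^sub>H I"])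
      (use contW contW' dx dy CR in \<open>auto simp: W_def\<close>)
qed

section \<open>Power series in a quaternionic variable\<close>

text \<open>
  The differential of \<open>p \<mapsto> p\<^sup>n\<close> in the direction \<open>h\<close>, that is \<open>\<Sum>\<^sub>i p\<^sup>i h p\<^sup>n\<^sup>-\<^sup>1\<^sup>-\<^sup>i\<close>; without
  commutativity it does not collapse to \<open>n p\<^sup>n\<^sup>-\<^sup>1 h\<close>.
\<close>

primrec quat_power_deriv :: "nat \<Rightarrow> quat \<Rightarrow> quat \<Rightarrow> quat" where
  "quat_power_deriv 0 p h = 0"
| "quat_power_deriv (Suc n) p h = p * quat_power_deriv n p h + h * p ^ n"

lemma has_derivative_quat_power:
  "((\<lambda>p. p ^ n) has_derivative quat_power_deriv n p) (at p within S)"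
proof (induction n)
  case (Suc n)
  from has_derivative_mult [OF has_derivative_ident this] show ?case by simp
qed simp

lemma norm_quat_power_deriv_le:
  assumes "norm p \<le> \<rho>"
  shows "norm (quat_power_deriv n p h) \<le> real n * \<rho> ^ (n - 1) * norm h"
proof (induction n)
  case (Suc n)
  have \<rho>: "\<rho> \<ge> 0" using assms norm_ge_zero order_trans by blast
  have "norm (quat_power_deriv (Suc n) p h) \<le> norm p * norm (quat_power_deriv n p h) + norm h * norm p ^ n"
    by (simp add: norm_mult norm_power norm_triangle_le)
  also have "\<dots> \<le> \<rho> * (real n * \<rho> ^ (n - 1) * norm h) + norm h * \<rho> ^ n"
    using assms Suc \<rho> by (intro add_mono mult_mono power_mono) auto
  also have "\<rho> * (real n * \<rho> ^ (n - 1) * norm h) = real n * \<rho> ^ n * norm h"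
    by (cases n) simp_all
  finally show ?case by (simp add: algebra_simps)
qed simp

lemma quat_power_deriv_commute:
  assumes "h * p = p * h"
  shows "quat_power_deriv n p h = (real n *\<^sub>R p ^ (n - 1)) * h"
proof (induction n)
  case (Suc n)
  have "h * p ^ n = p ^ n * h" using power_commuting_commutes [OF assms [symmetric], of n] by simp
  moreover have "p * (real n *\<^sub>R p ^ (n - 1)) = real n *\<^sub>R p ^ n" by (cases n) simp_all
  ultimately show ?case
    by (simp add: Suc mult.assoc [symmetric] scaleR_left_distrib distrib_right)
qed simp

definition quat_series :: "(nat \<Rightarrow> 'v::quat_hilbert) \<Rightarrow> quat \<Rightarrow> 'v" where
  "quat_series w p = (\<Sum>n. w n *\<^sub>H p ^ n)"

lemma summable_quat_series:
  fixes w :: "nat \<Rightarrow> 'v::quat_hilbert"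
  assumes w: "\<And>n. norm (w n) \<le> M * C ^ n" and p: "C * norm p < 1" and C: "C > 0"
  shows "summable (\<lambda>n. w n *\<^sub>H p ^ n)"
proof (rule summable_comparison_test')
  show "summable (\<lambda>n. M * (C * norm p) ^ n)"
    using p C by (intro summable_mult summable_geometric) simp
  show "norm (w n *\<^sub>H p ^ n) \<le> M * (C * norm p) ^ n" for n
    using mult_right_mono [OF w, of "norm p ^ n" n]
    by (simp add: norm_scaleQ norm_power power_mult_distrib mult.assoc)
qed

lemma quat_series_0: "quat_series w 0 = w 0"
proof -
  have "(\<lambda>n. w n *\<^sub>H 0 ^ n) sums (w 0 *\<^sub>H 0 ^ 0)"
    using sums_finite [of "{0}" "\<lambda>n. w n *\<^sub>H 0 ^ n"] by (simp add: power_0_left scaleQ.zero_right)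
  then show ?thesis unfolding quat_series_def by (simp add: sums_iff)
qed

lemma bounded_qlinear_quat_series:
  fixes w :: "nat \<Rightarrow> 'v::quat_hilbert"
  assumes T: "bounded_qlinear T" and sm: "summable (\<lambda>n. w n *\<^sub>H p ^ n)"
  shows "T (quat_series w p) = quat_series (T \<circ> w) p"
proof -
  have "bounded_linear T" and TQ: "\<And>x q. T (x *\<^sub>H q) = T x *\<^sub>H q"
    using T by (simp_all add: bounded_qlinear_def)
  from bounded_linear.suminf [OF this(1) sm, symmetric] show ?thesis
    by (simp add: quat_series_def TQ)
qed

text \<open>
  A backward shift of the coefficients, such as the one effected by an operator on a chain of
  preimages starting in its kernel, amounts to multiplication by the variable.
\<close>

lemma quat_series_shift:
  fixes w :: "nat \<Rightarrow> 'v::quat_hilbert"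
  assumes w0: "v 0 = 0" and wS: "\<And>n. v (Suc n) = w n" and sm: "summable (\<lambda>n. w n *\<^sub>H p ^ n)"
  shows "quat_series v p = quat_series w p *\<^sub>H p"
proof -
  have bl: "bounded_linear (\<lambda>x::'v. x *\<^sub>H p)" by (rule scaleQ.bounded_linear_left)
  have eq: "v (Suc n) *\<^sub>H p ^ Suc n = (w n *\<^sub>H p ^ n) *\<^sub>H p" for n
    by (simp only: wS scaleQ_scaleQ power_Suc2)
  have "summable (\<lambda>n. v (Suc n) *\<^sub>H p ^ Suc n)"
    unfolding eq by (rule bounded_linear.summable [OF bl sm])
  then have "summable (\<lambda>n. v n *\<^sub>H p ^ n)" using summable_Suc_iff [of "\<lambda>n. v n *\<^sub>H p ^ n"] by blast
  from suminf_split_head [OF this] have "quat_series v p = (\<Sum>n. v (Suc n) *\<^sub>H p ^ Suc n)"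
    by (simp add: quat_series_def w0 scaleQ.zero_left)
  also have "\<dots> = quat_series w p *\<^sub>H p"
    unfolding eq quat_series_def by (rule bounded_linear.suminf [OF bl sm, symmetric])
  finally show ?thesis .
qed

definition series_deriv :: "(nat \<Rightarrow> 'v::real_vector) \<Rightarrow> nat \<Rightarrow> 'v" where
  "series_deriv w n = real (Suc n) *\<^sub>R w (Suc n)"

text \<open>
  The factor \<open>n + 1 \<le> 2\<^sup>n\<close> is absorbed by doubling the growth rate, at the price of half the radius
  of convergence, which is harmless for local arguments.
\<close>

lemma norm_series_deriv_le:
  assumes w: "\<And>n. norm (w n) \<le> M * C ^ n" and C: "C > 0"
  shows "norm (series_deriv w n) \<le> (M * C) * (2 * C) ^ n"
proof -
  have "0 \<le> norm (w 0)" by simp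
  also have "\<dots> \<le> M * C ^ 0" by (rule w)
  finally have M: "M \<ge> 0" by simp
  have "real (Suc n) \<le> 2 ^ n"
    by (induction n) (auto simp: algebra_simps)
  then have "real (Suc n) * norm (w (Suc n)) \<le> 2 ^ n * (M * C ^ Suc n)"
    using w [of "Suc n"] by (intro mult_mono) auto
  then show ?thesis by (simp add: series_deriv_def power_mult_distrib mult_ac)
qed

text \<open>
  Termwise differentiation: on a ball of radius \<open>\<rho> < 1 / C\<close> the differentials of the terms are
  dominated by \<open>M C\<^sup>n n \<rho>\<^sup>n\<^sup>-\<^sup>1\<close>, a summable sequence. In directions commuting with the point each of
  them is a right multiplication, so the sum is one too.
\<close>

lemma quat_series_has_slice_derivative:
  fixes w :: "nat \<Rightarrow> 'v::quat_hilbert"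
  assumes w: "\<And>n. norm (w n) \<le> M * C ^ n" and p: "C * norm p < 1" and C: "C > 0"
  shows "has_slice_derivative (quat_series w) (quat_series (series_deriv w) p) p"
proof -
  obtain \<rho> where \<rho>: "norm p < \<rho>" "\<rho> < 1 / C"
    using p C dense [of "norm p" "1 / C"] by (auto simp: field_simps)
  have \<rho>0: "\<rho> > 0" using \<rho>(1) norm_ge_zero le_less_trans by blast
  have C\<rho>: "C * \<rho> < 1" using \<rho> C by (simp add: field_simps)
  define f' where "f' n x h = w n *\<^sub>H quat_power_deriv n x h" for n x h
  define g' where "g' x h = (\<Sum>n. f' n x h)" for x h
  define b where "b n = M * C ^ n * (real n * \<rho> ^ (n - 1))" for n
  have "(\<lambda>n. real (Suc n) * (C * \<rho>) ^ n) sums (1 / (1 - C * \<rho>)\<^sup>2)"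
    using geometric_deriv_sums [of "C * \<rho>"] C \<rho>0 C\<rho> by simp
  from summable_mult [OF sums_summable [OF this], of "M * C"]
  have "summable (\<lambda>n. b (Suc n))"
    by (simp add: b_def power_mult_distrib mult_ac)
  then have smb: "summable b" using summable_Suc_iff [of b] by blast
  have f'_le: "norm (f' n x h) \<le> b n * norm h" if x: "x \<in> ball 0 \<rho>" for n x h
  proof -
    have "norm (f' n x h) \<le> (M * C ^ n) * (real n * \<rho> ^ (n - 1) * norm h)"
      unfolding f'_def norm_scaleQ
      using x order_trans [OF norm_ge_zero w [of n]] w
      by (intro mult_mono norm_quat_power_deriv_le) auto
    then show ?thesis by (simp add: b_def mult_ac)
  qed
  have smf': "summable (\<lambda>n. f' n x h)" if "x \<in> ball 0 \<rho>" for x h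
    by (rule summable_comparison_test' [OF summable_mult2 [OF smb, of "norm h"] f'_le [OF that]])
  have "\<exists>G. \<forall>x\<in>ball 0 \<rho>. (\<lambda>n. w n *\<^sub>H x ^ n) sums G x \<and> (G has_derivative g' x) (at x within ball 0 \<rho>)"
  proof (rule has_derivative_series)
    show "convex (ball (0::quat) \<rho>)" by simp
    show "((\<lambda>p. w n *\<^sub>H p ^ n) has_derivative f' n x) (at x within ball 0 \<rho>)" for n x
      unfolding f'_def
      by (rule bounded_linear.has_derivative [OF scaleQ.bounded_linear_right has_derivative_quat_power])
    show "0 \<in> ball (0::quat) \<rho>" using \<rho>0 by simp
    show "(\<lambda>n. w n *\<^sub>H 0 ^ n) sums quat_series w 0"
      unfolding quat_series_def by (intro summable_sums summable_quat_series [OF w]) (simp_all add: C)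
    fix e :: real assume e: "e > 0"
    obtain N where N: "\<And>n. n \<ge> N \<Longrightarrow> norm (\<Sum>i. b (i + n)) < e"
      using suminf_exist_split [OF e smb] by blast
    have "norm ((\<Sum>i<n. f' i x h) - g' x h) \<le> e * norm h" if n: "n \<ge> N" and x: "x \<in> ball 0 \<rho>" for n x h
    proof -
      have smn: "summable (\<lambda>i. b (i + n))" using smb by (simp add: summable_iff_shift)
      have "(\<Sum>i<n. f' i x h) - g' x h = - (\<Sum>i. f' (i + n) x h)"
        unfolding g'_def using suminf_minus_initial_segment [OF smf' [OF x, of h], of n] by simp
      then have "norm ((\<Sum>i<n. f' i x h) - g' x h) \<le> (\<Sum>i. b (i + n) * norm h)"
        using norm_suminf_le [of "\<lambda>i. f' (i + n) x h" "\<lambda>i. b (i + n) * norm h"]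
          f'_le [OF x] summable_mult2 [OF smn] by simp
      also have "\<dots> = (\<Sum>i. b (i + n)) * norm h"
        by (rule suminf_mult2 [OF smn, symmetric])
      also have "\<dots> \<le> e * norm h"
        using N [OF n] by (intro mult_right_mono) auto
      finally show ?thesis .
    qed
    then show "\<forall>\<^sub>F n in sequentially. \<forall>x\<in>ball 0 \<rho>. \<forall>h. norm ((\<Sum>i<n. f' i x h) - g' x h) \<le> e * norm h"
      unfolding eventually_sequentially by blast
  qed
  then obtain G where G: "\<And>x. x \<in> ball 0 \<rho> \<Longrightarrow> (\<lambda>n. w n *\<^sub>H x ^ n) sums G x"
    "\<And>x. x \<in> ball 0 \<rho> \<Longrightarrow> (G has_derivative g' x) (at x within ball 0 \<rho>)" by blast
  have pb: "p \<in> ball 0 \<rho>" using \<rho> by simp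
  have "(G has_derivative g' p) (at p)"
    using G(2) [OF pb] at_within_open [OF pb] by simp
  then have "(quat_series w has_derivative g' p) (at p)"
    by (rule has_derivative_transform_within_open [OF _ open_ball pb])
      (use G(1) in \<open>simp add: quat_series_def sums_iff\<close>)
  moreover have "g' p h = quat_series (series_deriv w) p *\<^sub>H h" if h: "h * p = p * h" for h
  proof -
    have eq: "f' (Suc n) p h = (series_deriv w n *\<^sub>H p ^ n) *\<^sub>H h" for n
      by (simp add: f'_def quat_power_deriv_commute [OF h] series_deriv_def scaleQ_scaleQ
          scaleQ.scaleR_left scaleQ.scaleR_right del: quat_power_deriv.simps of_nat_Suc)
    have smd: "summable (\<lambda>n. series_deriv w n *\<^sub>H p ^ n)"
    proof -
      have "f' (Suc n) p 1 = series_deriv w n *\<^sub>H p ^ n" for n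
        by (simp add: f'_def quat_power_deriv_commute series_deriv_def
          scaleQ.scaleR_left scaleQ.scaleR_right del: quat_power_deriv.simps of_nat_Suc)
      then show ?thesis using smf' [OF pb, of 1] summable_Suc_iff [of "\<lambda>n. f' n p 1"] by simp
    qed
    have "g' p h = (\<Sum>n. f' (Suc n) p h)"
      unfolding g'_def using suminf_split_head [OF smf' [OF pb, of h]]
      by (simp add: f'_def scaleQ.zero_right)
    also have "\<dots> = quat_series (series_deriv w) p *\<^sub>H h"
      unfolding eq quat_series_def
      by (rule bounded_linear.suminf [OF scaleQ.bounded_linear_left smd, symmetric])
    finally show ?thesis .
  qed
  ultimately show ?thesis unfolding has_slice_derivative_def by blast
qed

section \<open>Local eigenvector families\<close>

text \<open>
  The real polynomial \<open>Q\<close> whose zero set is the sphere of all quaternions conjugate to \<open>q0\<close>, and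
  with \<open>Rq A q0 = Q(A)\<close>.
\<close>

definition sphere_poly :: "quat \<Rightarrow> quat \<Rightarrow> quat" where
  "sphere_poly q0 q = q * q - (2 * qRe q0) *\<^sub>R q + of_real ((norm q0)\<^sup>2)"

lemma norm_quat_squared: "(norm q)\<^sup>2 = (qRe q)\<^sup>2 + (qI q)\<^sup>2 + (qJ q)\<^sup>2 + (qK q)\<^sup>2"
  for q :: quat
  by (simp add: norm_quat_def)

lemma sphere_poly_self: "sphere_poly q q = 0"
  unfolding sphere_poly_def norm_quat_squared quat_eq_iff
  by (simp add: power2_eq_square algebra_simps del: of_real_add of_real_mult of_real_power)

lemma sphere_poly_on_slice:
  "sphere_poly q0 (Quat (qRe q0) y 0 0) = of_real ((norm q0)\<^sup>2 - (qRe q0)\<^sup>2 - y\<^sup>2)"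
  unfolding sphere_poly_def quat_eq_iff
  by (simp add: power2_eq_square algebra_simps del: of_real_add of_real_mult of_real_power of_real_diff)

lemma has_derivative_sphere_poly:
  "(sphere_poly q0 has_derivative (\<lambda>h. q * h + h * q - (2 * qRe q0) *\<^sub>R h)) (at q)"
  unfolding sphere_poly_def
  by (auto intro!: derivative_eq_intros has_derivative_mult)

lemma sphere_poly_deriv_commute:
  assumes "h * q = q * h"
  shows "q * h + h * q - (2 * qRe q0) *\<^sub>R h = (2 *\<^sub>R (q - of_real (qRe q0))) * h"
  by (simp add: assms of_real_def algebra_simps scaleR_2)

lemma commute_sphere_poly:
  assumes "h * q = q * h"
  shows "h * sphere_poly q0 q = sphere_poly q0 q * h"
proof -
  have "h * (q * q) = (q * q) * h" by (metis assms mult.assoc)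
  then show ?thesis
    by (simp add: sphere_poly_def of_real_def assms distrib_left distrib_right
        left_diff_distrib right_diff_distrib)
qed

text \<open>
  The chain rule holds because \<open>Q\<close> has real coefficients: it maps every slice into itself, so a
  direction commuting with \<open>q\<close> is sent to one commuting with \<open>Q(q)\<close>.
\<close>

lemma has_slice_derivative_compose_sphere_poly:
  assumes "has_slice_derivative G d (sphere_poly q0 q)"
  shows "has_slice_derivative (\<lambda>q. G (sphere_poly q0 q)) (d *\<^sub>H (2 *\<^sub>R (q - of_real (qRe q0)))) q"
proof -
  let ?Q' = "\<lambda>h. q * h + h * q - (2 * qRe q0) *\<^sub>R h"
  obtain F where F: "(G has_derivative F) (at (sphere_poly q0 q))"
    "\<And>h. h * sphere_poly q0 q = sphere_poly q0 q * h \<Longrightarrow> F h = d *\<^sub>H h"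
    using assms unfolding has_slice_derivative_def by blast
  have "((\<lambda>q. G (sphere_poly q0 q)) has_derivative (\<lambda>h. F (?Q' h))) (at q)"
    by (rule has_derivative_compose [OF has_derivative_sphere_poly F(1)])
  moreover have "F (?Q' h) = (d *\<^sub>H (2 *\<^sub>R (q - of_real (qRe q0)))) *\<^sub>H h" if h: "h * q = q * h" for h
  proof -
    let ?e = "2 *\<^sub>R (q - of_real (qRe q0)) * h"
    have "?e * q = q * ?e"
      using h by (simp add: of_real_def left_diff_distrib right_diff_distrib mult.assoc)
    then have "F ?e = d *\<^sub>H ?e" by (intro F(2) commute_sphere_poly)
    then show ?thesis by (simp only: sphere_poly_deriv_commute [OF h] scaleQ_scaleQ)
  qed
  ultimately show ?thesis unfolding has_slice_derivative_def by blast
qed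

lemma Rq_eigenvector:
  assumes A: "bounded_qlinear A" and ev: "A v = v *\<^sub>H q"
  shows "Rq A q v = 0"
proof -
  have AQ: "A (v *\<^sub>H q) = A v *\<^sub>H q" using A by (simp add: bounded_qlinear_def)
  have "v *\<^sub>H sphere_poly q q = (v *\<^sub>H q) *\<^sub>H q - (2 * qRe q) *\<^sub>R (v *\<^sub>H q) + (norm q)\<^sup>2 *\<^sub>R v"
    by (simp only: sphere_poly_def scaleQ.add_right scaleQ.diff_right scaleQ_scaleQ
        scaleQ.scaleR_right scaleQ_of_real)
  then show ?thesis
    by (simp add: Rq_def ev AQ sphere_poly_self scaleQ.zero_right)
qed

text \<open>
  The construction of local eigenvectors \<open>f\<close> out of a chain over the kernel. The hypotheses on \<open>T\<close>
  are not phrased as the Kato condition because in this form they can be verified directly for the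
  adjoint of a Kato operator.
\<close>

lemma SVEP_imp_trivial_kernel:
  fixes A :: "'v::quat_hilbert \<Rightarrow> 'v"
  assumes A: "bounded_qlinear A" and svep: "SVEP_at A q0"
    and C: "C > 0"
      "\<And>y. y \<in> range (Rq A q0) \<Longrightarrow> \<exists>x. Rq A q0 x = y \<and> norm x \<le> C * norm y"
    and ker: "\<And>n. {x. (Rq A q0 ^^ n) x = 0} \<subseteq> range (Rq A q0)"
    and w0: "Rq A q0 w0 = 0"
  shows "w0 = 0"
proof -
  define T where "T = Rq A q0"
  define x0 where "x0 = qRe q0"
  define Q where "Q = sphere_poly q0"
  have T: "bounded_qlinear T" unfolding T_def by (rule bounded_qlinear_Rq [OF A])
  interpret A: bounded_linear A using A by (simp add: bounded_qlinear_def)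
  have AQ: "A (x *\<^sub>H q) = A x *\<^sub>H q" for x q using A by (simp add: bounded_qlinear_def)
  obtain w where w: "w 0 = w0" "\<And>n. T (w (Suc n)) = w n" "\<And>n. norm (w n) \<le> norm w0 * C ^ n"
    using bounded_chain_over_kernel [OF C ker w0] unfolding T_def by blast
  \<comment> \<open>Half of the radius of convergence, so that the derivative series is also under control.\<close>
  define r where "r = 1 / (2 * C)"
  have r: "r > 0" using C by (simp add: r_def)
  define U where "U = {q. norm (Q q) < r}"
  have small: "C * norm p < 1" "2 * C * norm p < 1" if "norm p < r" for p :: quat
  proof -
    have "C * norm p < C * r" using that C by simp
    also have "C * r = 1 / 2" using C by (simp add: r_def)
    finally show "C * norm p < 1" "2 * C * norm p < 1" by simp_all
  qed
  have contQ: "continuous_on UNIV Q"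
    unfolding Q_def sphere_poly_def by (intro continuous_intros)
  have openU: "open U"
    unfolding U_def using contQ by (intro open_Collect_less continuous_intros) 
  have q0: "q0 \<in> U" using r by (simp add: U_def Q_def sphere_poly_self)
  define g where "g q = quat_series w (Q q)" for q
  define g1 where "g1 q = quat_series (series_deriv w) (Q q) *\<^sub>H (2 *\<^sub>R (q - of_real x0))" for q
  define f where "f q = A (g q) + g q *\<^sub>H q - (2 * x0) *\<^sub>R g q" for q
  \<comment> \<open>The slice derivatives of \<open>g\<close> and \<open>f\<close> are \<open>g1\<close> and \<open>f1\<close>.\<close>
  define f1 where "f1 q = A (g1 q) + (g1 q *\<^sub>H q + g q) - (2 * x0) *\<^sub>R g1 q" for q

  have series_der: "has_slice_derivative (quat_series w) (quat_series (series_deriv w) p) p"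
    if "norm p < r" for p
    by (rule quat_series_has_slice_derivative [OF w(3) small(1) [OF that] C(1)])
  have g_der: "has_slice_derivative g (g1 q) q" if "q \<in> U" for q
    unfolding g_def [abs_def] g1_def Q_def x0_def
    by (intro has_slice_derivative_compose_sphere_poly series_der [unfolded Q_def])
      (use that in \<open>simp add: U_def Q_def\<close>)
  have f_der: "has_slice_derivative f (f1 q) q" if q: "q \<in> U" for q
  proof -
    obtain F where F: "(g has_derivative F) (at q)" "\<And>h. h * q = q * h \<Longrightarrow> F h = g1 q *\<^sub>H h"
      using g_der [OF q] unfolding has_slice_derivative_def by blast
    have "(f has_derivative (\<lambda>h. A (F h) + (g q *\<^sub>H h + F h *\<^sub>H q) - (2 * x0) *\<^sub>R F h)) (at q)"
      unfolding f_def [abs_def]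
      by (intro has_derivative_add has_derivative_diff A.has_derivative scaleQ.FDERIV F
          has_derivative_ident has_derivative_scaleR_right)
    moreover have "A (F h) + (g q *\<^sub>H h + F h *\<^sub>H q) - (2 * x0) *\<^sub>R F h = f1 q *\<^sub>H h"
      if h: "h * q = q * h" for h
      unfolding F(2) [OF h] f1_def AQ
      by (simp add: scaleQ.add_left scaleQ.diff_left scaleQ.scaleR_left scaleQ_scaleQ h)
    ultimately show ?thesis unfolding has_slice_derivative_def by blast
  qed
  have "continuous_on U g"
    using g_der has_slice_derivative_imp_isCont continuous_at_imp_continuous_on by blast
  moreover have "continuous_on U g1"
  proof -
    have "isCont (quat_series (series_deriv w)) p" if "norm p < r" for p
      using quat_series_has_slice_derivative [OF norm_series_deriv_le [OF w(3) C(1)] small(2) [OF that]]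
        C(1) has_slice_derivative_imp_isCont by simp
    then have "continuous_on {p. norm p < r} (quat_series (series_deriv w))"
      by (simp add: continuous_at_imp_continuous_on)
    then have "continuous_on U (\<lambda>q. quat_series (series_deriv w) (Q q))"
      by (rule continuous_on_compose2) (use contQ continuous_on_subset in \<open>auto simp: U_def\<close>)
    then show ?thesis unfolding g1_def
      by (intro scaleQ.continuous_on continuous_intros)
  qed
  ultimately have "continuous_on U f1"
    unfolding f1_def by (intro continuous_intros A.continuous_on scaleQ.continuous_on)
  with openU f_der have regular: "right_slice_regular_on U f"
    by (rule right_slice_regular_onI)
  have contf: "continuous_on U f"
    using f_der has_slice_derivative_imp_isCont continuous_at_imp_continuous_on by blast

  have eigen: "A (f q) = f q *\<^sub>H q" if q: "q \<in> U" for q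
  proof -
    have sm: "summable (\<lambda>n. w n *\<^sub>H Q q ^ n)"
      using q by (intro summable_quat_series [OF w(3)] small(1) C) (simp add: U_def)
    have "T (g q) = quat_series (T \<circ> w) (Q q)"
      unfolding g_def by (rule bounded_qlinear_quat_series [OF T sm])
    also have "\<dots> = g q *\<^sub>H Q q"
      unfolding g_def using w w0 sm by (intro quat_series_shift) (simp_all add: T_def)
    finally have "A (A (g q)) - (2 * x0) *\<^sub>R A (g q) + (norm q0)\<^sup>2 *\<^sub>R g q
        = (g q *\<^sub>H q) *\<^sub>H q - (2 * x0) *\<^sub>R (g q *\<^sub>H q) + (norm q0)\<^sup>2 *\<^sub>R g q"
      by (simp only: T_def Rq_def x0_def Q_def sphere_poly_def scaleQ.add_right scaleQ.diff_right
          scaleQ_scaleQ scaleQ.scaleR_right scaleQ_of_real)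
    then show ?thesis
      by (simp add: f_def A.add A.diff A.scaleR AQ scaleQ.add_left scaleQ.diff_left
          scaleQ.scaleR_left)
  qed
  then have zero: "f q = 0" if "q \<in> U" for q
    using svep openU q0 contf regular that Rq_eigenvector [OF A] unfolding SVEP_at_def by blast

  have vanish: "quat_series w (of_real (- t)) = 0" if t: "0 < t" "t < r" for t
  proof -
    \<comment> \<open>This \<open>y\<close> is the one for which \<open>Q\<close> takes the value \<open>- t\<close> at \<open>x0 + y I\<close> and at \<open>x0 - y I\<close>.\<close>
    define y where "y = sqrt ((norm q0)\<^sup>2 - x0\<^sup>2 + t)"
    have "(norm q0)\<^sup>2 - x0\<^sup>2 \<ge> 0" by (simp add: norm_quat_squared x0_def)
    then have y: "y > 0" "y\<^sup>2 = (norm q0)\<^sup>2 - x0\<^sup>2 + t" using t by (simp_all add: y_def)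
    define q where "q s = Quat x0 s 0 0" for s
    have Qq: "Q (q s) = of_real (- t)" if "s = y \<or> s = - y" for s
    proof -
      have "(norm q0)\<^sup>2 - x0\<^sup>2 - s\<^sup>2 = - t" using that y(2) by auto
      then show ?thesis by (simp only: Q_def q_def x0_def sphere_poly_on_slice)
    qed
    have "f (q s) = 0" if "s = y \<or> s = - y" for s
      using t by (intro zero) (simp add: U_def Qq [OF that])
    then have "f (q y) - f (q (- y)) = 0" by simp
    then have "g (q y) *\<^sub>H (q y - q (- y)) = 0"
      by (simp add: f_def g_def Qq scaleQ.diff_right)
    then have "norm (g (q y)) * norm (q y - q (- y)) = 0"
      by (metis norm_scaleQ norm_zero)
    moreover have "q y - q (- y) \<noteq> 0" using y(1) by (simp add: q_def quat_eq_iff)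
    ultimately show ?thesis by (simp add: g_def Qq)
  qed
  \<comment> \<open>Zeros accumulating at the origin; the offset 2 keeps \<open>t = r / (n + 2)\<close> strictly below \<open>r\<close>.\<close>
  have "(\<lambda>n. - (r / real (n + 2))) \<longlonglongrightarrow> - 0"
    using LIMSEQ_ignore_initial_segment [OF lim_const_over_n [of r], of 2] by (rule tendsto_minus)
  then have "(\<lambda>n. of_real (- (r / real (n + 2))) :: quat) \<longlonglongrightarrow> of_real (- 0)"
    by (rule tendsto_of_real)
  moreover have "isCont (quat_series w) (of_real (- 0))"
    using has_slice_derivative_imp_isCont [OF series_der [of 0]] r by simp
  ultimately have "(\<lambda>n. quat_series w (of_real (- (r / real (n + 2))))) \<longlonglongrightarrow> quat_series w (of_real (- 0))"
    by (rule isCont_tendsto_compose [rotated])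
  moreover have "quat_series w (of_real (- (r / real (n + 2)))) = 0" for n
    using r by (intro vanish) (auto simp: field_simps add_pos_nonneg)
  ultimately show "w0 = 0"
    by (simp add: quat_series_0 w(1) LIMSEQ_const_iff)
qed

section \<open>Kato points\<close>

lemma bounded_below_iff_not_approx_S_spectrum:
  assumes A: "bounded_qlinear A"
  shows "q \<notin> approx_S_spectrum A \<longleftrightarrow> (\<exists>c>0. \<forall>x. c * norm x \<le> norm (Rq A q x))"
proof
  interpret T: bounded_linear "Rq A q"
    using bounded_qlinear_Rq [OF A] by (simp add: bounded_qlinear_def)
  assume q: "q \<notin> approx_S_spectrum A"
  show "\<exists>c>0. \<forall>x. c * norm x \<le> norm (Rq A q x)"
  proof (rule ccontr)
    assume "\<not> ?thesis"
    then have "\<exists>x. norm (Rq A q x) < 1 / real (Suc n) * norm x" for n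
      by (metis not_le of_nat_0_less_iff zero_less_Suc zero_less_divide_1_iff)
    then obtain x where x: "\<And>n. norm (Rq A q (x n)) < 1 / real (Suc n) * norm (x n)" by metis
    have nz: "norm (x n) > 0" for n
      using x [of n] by (metis T.zero mult_zero_right norm_zero not_less_iff_gr_or_eq zero_less_norm_iff)
    define \<phi> where "\<phi> n = x n /\<^sub>R norm (x n)" for n
    have "norm (\<phi> n) = 1" for n using nz [of n] by (simp add: \<phi>_def)
    moreover have "(\<lambda>n. norm (Rq A q (\<phi> n))) \<longlonglongrightarrow> 0"
    proof (rule Lim_null_comparison [OF _ LIMSEQ_Suc [OF lim_1_over_n]])
      have "norm (Rq A q (\<phi> n)) \<le> 1 / real (Suc n)" for n
        using x [of n] nz [of n] by (simp add: \<phi>_def T.scaleR field_simps)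
      then show "\<forall>\<^sub>F n in sequentially. norm (norm (Rq A q (\<phi> n))) \<le> 1 / real (Suc n)" by simp
    qed
    ultimately show False using q by (auto simp: approx_S_spectrum_def)
  qed
next
  assume "\<exists>c>0. \<forall>x. c * norm x \<le> norm (Rq A q x)"
  then obtain c where c: "c > 0" "\<And>x. c * norm x \<le> norm (Rq A q x)" by blast
  show "q \<notin> approx_S_spectrum A"
  proof
    assume "q \<in> approx_S_spectrum A"
    then obtain \<phi> where \<phi>: "\<And>n::nat. norm (\<phi> n) = 1" "(\<lambda>n. norm (Rq A q (\<phi> n))) \<longlonglongrightarrow> 0"
      by (auto simp: approx_S_spectrum_def)
    have "c \<le> 0"
      by (rule LIMSEQ_le_const [OF \<phi>(2)]) (metis c(2) \<phi>(1) mult.right_neutral)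
    with c(1) show False by simp
  qed
qed

lemma kato_point_trivial_kernel:
  fixes A :: "'v::quat_hilbert \<Rightarrow> 'v"
  assumes A: "bounded_qlinear A" and svep: "SVEP_at A q" and q: "q \<in> kato_S_resolvent A"
    and x: "Rq A q x = 0"
  shows "x = 0"
proof -
  have T: "bounded_linear (Rq A q)"
    using bounded_qlinear_Rq [OF A] by (simp add: bounded_qlinear_def)
  have cl: "closed (range (Rq A q))" and ker: "{x. Rq A q x = 0} \<subseteq> range (Rq A q ^^ n)" for n
    using q by (auto simp: kato_S_resolvent_def)
  obtain C where C: "C > 0"
    "\<And>y. y \<in> range (Rq A q) \<Longrightarrow> \<exists>x. Rq A q x = y \<and> norm x \<le> C * norm y"
    using closed_range_bounded_preimages [OF T cl] by blast
  have "{x. (Rq A q ^^ n) x = 0} \<subseteq> range (Rq A q)" for n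
    using kernel_funpow_subset_range_funpow [OF bounded_linear.linear [OF T] ker, of n _ 1] by auto
  from SVEP_imp_trivial_kernel [OF A svep C this x] show ?thesis .
qed

text \<open>
  Surjectivity is injectivity of the adjoint \<open>S\<close>, to which \<open>SVEP_imp_trivial_kernel\<close> applies: vectors
  in the kernel of \<open>S\<^sup>n\<close> are orthogonal to \<open>ran T\<^sup>n\<close>, hence to \<open>ker T\<close>, and so lie in the range of \<open>S\<close>.
\<close>

lemma kato_point_surjective:
  fixes A :: "'v::quat_hilbert \<Rightarrow> 'v"
  assumes A: "bounded_qlinear A" and svep: "SVEP_at (qadjoint A) q"
    and q: "q \<in> kato_S_resolvent A"
  shows "range (Rq A q) = UNIV"
proof -
  define T where "T = Rq A q"
  define S where "S = Rq (qadjoint A) q"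
  have T: "bounded_linear T"
    using bounded_qlinear_Rq [OF A] by (simp add: T_def bounded_qlinear_def)
  have adj: "rinner x (T y) = rinner (S x) y" for x y
    unfolding T_def S_def by (rule rinner_Rq_qadjoint [OF A])
  have adj_pow: "rinner x ((T ^^ n) y) = rinner ((S ^^ n) x) y" for n x y
    by (induction n arbitrary: x) (simp, simp add: adj, simp add: funpow_swap1)
  have cl: "closed (range T)" and ker: "{x. T x = 0} \<subseteq> range (T ^^ n)" for n
    using q by (auto simp: kato_S_resolvent_def T_def)
  obtain C where C: "C > 0" "\<And>y. y \<in> range T \<Longrightarrow> \<exists>x. T x = y \<and> norm x \<le> C * norm y"
    using closed_range_bounded_preimages [OF T cl] by blast
  have r0: "rinner 0 z = 0" "rinner z 0 = 0" for z :: 'v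
    using rinner_scaleR_left [of 0 0 z] rinner_scaleR_right [of z 0 0] by simp_all
  have preimage: "\<exists>u. S u = y \<and> norm u \<le> C * norm y" if "\<And>x. T x = 0 \<Longrightarrow> rinner y x = 0" for y
    by (rule adjoint_bounded_preimages [OF T cl adj C that])
  have S_preimage: "\<exists>u. S u = y \<and> norm u \<le> C * norm y" if "y \<in> range S" for y
    using that by (intro preimage) (auto simp: adj [symmetric] r0)
  have S_ker: "{x. (S ^^ n) x = 0} \<subseteq> range S" for n
  proof clarify
    fix y assume y: "(S ^^ n) y = 0"
    have "rinner y x = 0" if x: "T x = 0" for x
    proof -
      obtain u where "x = (T ^^ n) u" using ker [of n] x by blast
      then show ?thesis by (simp add: adj_pow y r0)
    qed
    then show "y \<in> range S" using preimage by blast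
  qed
  have "range T = UNIV"
  proof (rule closed_range_trivial_orthogonal_complement [OF T cl])
    fix v assume v: "\<And>x. rinner v (T x) = 0"
    have "S v = 0" by (rule rinner_eq_imp_eq) (simp add: adj [symmetric] v r0)
    then show "v = 0"
      using SVEP_imp_trivial_kernel [OF bounded_qlinear_qadjoint [OF A] svep C(1)] S_preimage S_ker
      unfolding S_def by blast
  qed
  then show ?thesis by (simp add: T_def)
qed

lemma bounded_below_imp_kato:
  assumes A: "bounded_qlinear A" and c: "c > 0" "\<And>x. c * norm x \<le> norm (Rq A q x)"
  shows "q \<in> kato_S_resolvent A"
proof -
  interpret T: bounded_linear "Rq A q"
    using bounded_qlinear_Rq [OF A] by (simp add: bounded_qlinear_def)
  have "x = 0" if "Rq A q x = 0" for x
    using c(1) c(2) [of x] that by (simp add: mult_le_0_iff)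
  moreover have "(Rq A q ^^ n) 0 = 0" for n
    by (induction n) (simp_all add: T.zero)
  then have "0 \<in> range (Rq A q ^^ n)" for n by (metis rangeI)
  moreover have "closed (range (Rq A q))"
    by (rule bounded_below_closed_range [OF T.bounded_linear_axioms c])
  ultimately show ?thesis unfolding kato_S_resolvent_def by blast
qed

lemma surjective_imp_kato:
  assumes "range (Rq A q) = UNIV"
  shows "q \<in> kato_S_resolvent A"
proof -
  have "range (Rq A q ^^ n) = UNIV" for n
    using assms by (rule surj_fn)
  then show ?thesis using assms by (simp add: kato_S_resolvent_def)
qed

lemma kato_point_bounded_below:
  assumes A: "bounded_qlinear A" and q: "q \<in> kato_S_resolvent A"
    and inj: "\<And>x. Rq A q x = 0 \<Longrightarrow> x = 0"
  obtains c where "c > 0" "\<And>x. c * norm x \<le> norm (Rq A q x)"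
proof -
  interpret T: bounded_linear "Rq A q"
    using bounded_qlinear_Rq [OF A] by (simp add: bounded_qlinear_def)
  have "closed (range (Rq A q))" using q by (simp add: kato_S_resolvent_def)
  then obtain C where C: "C > 0"
    "\<And>y. y \<in> range (Rq A q) \<Longrightarrow> \<exists>x. Rq A q x = y \<and> norm x \<le> C * norm y"
    using closed_range_bounded_preimages [OF T.bounded_linear_axioms] by blast
  show thesis
  proof
    show "1 / C > 0" using C by simp
    show "1 / C * norm x \<le> norm (Rq A q x)" for x
    proof -
      obtain x' where x': "Rq A q x' = Rq A q x" "norm x' \<le> C * norm (Rq A q x)"
        using C(2) by blast
      have "x' = x" using inj [of "x' - x"] x'(1) by (simp add: T.diff)
      then show ?thesis using x'(2) C(1) by (simp add: field_simps)
    qed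
  qed
qed

lemma not_S_spectrum_iff:
  assumes A: "bounded_qlinear A"
  shows "q \<notin> S_spectrum A \<longleftrightarrow>
    range (Rq A q) = UNIV \<and> (\<exists>c>0. \<forall>x. c * norm x \<le> norm (Rq A q x))"
proof
  define T where "T = Rq A q"
  have TQ: "T (x *\<^sub>H p) = T x *\<^sub>H p" for x p
    using bounded_qlinear_Rq [OF A] by (simp add: T_def bounded_qlinear_def)
  interpret T: bounded_linear T
    using bounded_qlinear_Rq [OF A] by (simp add: T_def bounded_qlinear_def)
  {
    assume "q \<notin> S_spectrum A"
    then obtain B where "bounded_qlinear B" and B: "B \<circ> T = id" "T \<circ> B = id"
      unfolding S_spectrum_def T_def by blast
    then interpret B: bounded_linear B by (simp add: bounded_qlinear_def)
    obtain K where K: "K > 0" "\<And>x. norm (B x) \<le> norm x * K" using B.pos_bounded by blast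
    have "1 / K * norm x \<le> norm (T x)" for x
      using K(2) [of "T x"] K(1) fun_cong [OF B(1), of x] by (simp add: field_simps)
    moreover have "1 / K > 0" using K by simp
    moreover have "range T = UNIV" using fun_cong [OF B(2)] by (metis comp_apply id_apply surjI)
    ultimately show "range (Rq A q) = UNIV \<and> (\<exists>c>0. \<forall>x. c * norm x \<le> norm (Rq A q x))"
      unfolding T_def by blast
  }
  {
    assume "range (Rq A q) = UNIV \<and> (\<exists>c>0. \<forall>x. c * norm x \<le> norm (Rq A q x))"
    then obtain c where surj: "range T = UNIV" and c: "c > 0" "\<And>x. c * norm x \<le> norm (T x)"
      unfolding T_def by blast
    have inj: "x = y" if "T x = T y" for x y
      using c(1) c(2) [of "x - y"] that by (simp add: T.diff mult_le_0_iff)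
    define B where "B = inv T"
    have TB: "T (B y) = y" for y unfolding B_def using surj by (simp add: surj_f_inv_f)
    have BT: "B (T x) = x" for x by (rule inj) (rule TB)
    have "bounded_linear B"
    proof (rule bounded_linear_intro)
      show "B (x + y) = B x + B y" for x y by (rule inj) (simp add: TB T.add)
      show "B (r *\<^sub>R x) = r *\<^sub>R B x" for r x by (rule inj) (simp add: TB T.scaleR)
      show "norm (B x) \<le> norm x * (1 / c)" for x
        using c(1) c(2) [of "B x"] by (simp add: TB field_simps)
    qed
    moreover have "B (x *\<^sub>H p) = B x *\<^sub>H p" for x p by (rule inj) (simp add: TB TQ)
    ultimately have "bounded_qlinear B" by (simp add: bounded_qlinear_def)
    moreover have "B \<circ> Rq A q = id" "Rq A q \<circ> B = id"
      using TB BT unfolding T_def by (simp_all add: fun_eq_iff)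
    ultimately show "q \<notin> S_spectrum A" unfolding S_spectrum_def by blast
  }
qed

section \<open>Kato, approximate point, surjectivity and S-spectrum\<close>

theorem corollary7p13:
  fixes A :: "'v::quat_hilbert \<Rightarrow> 'v"
  assumes "bounded_qlinear A"
  shows "(SVEP A \<longrightarrow> kato_S_spectrum A = approx_S_spectrum A) \<and>
         (SVEP (qadjoint A) \<longrightarrow> kato_S_spectrum A = surj_S_spectrum A) \<and>
         (SVEP A \<and> SVEP (qadjoint A) \<longrightarrow> kato_S_spectrum A = S_spectrum A)"
proof -
  have ap: "q \<in> kato_S_resolvent A \<longleftrightarrow> q \<notin> approx_S_spectrum A" if "SVEP A" for q
    unfolding bounded_below_iff_not_approx_S_spectrum [OF assms]
    using that kato_point_trivial_kernel [OF assms] kato_point_bounded_below [OF assms]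
      bounded_below_imp_kato [OF assms]
    unfolding SVEP_def by metis
  have su: "q \<in> kato_S_resolvent A \<longleftrightarrow> q \<notin> surj_S_spectrum A" if "SVEP (qadjoint A)" for q
    using that kato_point_surjective [OF assms] surjective_imp_kato
    unfolding SVEP_def surj_S_spectrum_def by blast
  have S: "q \<notin> S_spectrum A \<longleftrightarrow> q \<notin> surj_S_spectrum A \<and> q \<notin> approx_S_spectrum A" for q
    unfolding not_S_spectrum_iff [OF assms] bounded_below_iff_not_approx_S_spectrum [OF assms]
    by (simp add: surj_S_spectrum_def)
  show ?thesis
    unfolding kato_S_spectrum_def using ap su S by blast
qed

end
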